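(* Let $R$ be a ring and let $n\ge 1$ be an integer. (1) If $R$ is weakly $2$-primal and strongly unit nil-clean, then the full matrix ring $\mathbb{M}_n(R)$ is strongly unit nil-clean. (2) If $R$ is an NI-ring and $\mathbb{M}_n(R)$ is strongly unit nil-clean, then $R$ is strongly unit nil-clean.
   Context: Rings are associative with identity, not necessarily commutative. An element of a ring is strongly nil-clean if it is the sum of an idempotent $e$ and a nilpotent $b$ with $eb=be$. A ring $R$ is strongly unit nil-clean if for every $a\in R$ there is a unit $u\in R$ such that $ua$ is strongly nil-clean. $\mathrm{Nil}(R)$ denotes the set of nilpotent elements of $R$, and $L(R)$ the Levitzki radical, i.e. the largest locally nilpotent two-sided ideal of $R$ (an ideal is locally nilpotent if every finite subset of it generates a nilpotent subring without identity). $R$ is weakly $2$-primal if $\mathrm{Nil}(R)=L(R)$. $R$ is an NI-ring if $\mathrm{Nil}(R)$ is an ideal of $R$. *)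

theory Defs
  imports "HOL-Algebra.Algebra"
begin

definition idempotent_elem :: "('a, 'b) ring_scheme \<Rightarrow> 'a \<Rightarrow> bool" where
  "idempotent_elem R e \<longleftrightarrow> e \<in> carrier R \<and> e \<otimes>\<^bsub>R\<^esub> e = e"

definition nilpotents :: "('a, 'b) ring_scheme \<Rightarrow> 'a set" where
  "nilpotents R = {b \<in> carrier R. \<exists>k::nat. b [^]\<^bsub>R\<^esub> k = \<zero>\<^bsub>R\<^esub>}"

definition strongly_nil_clean_elem :: "('a, 'b) ring_scheme \<Rightarrow> 'a \<Rightarrow> bool" where
  "strongly_nil_clean_elem R a \<longleftrightarrow>
     (\<exists>e b. idempotent_elem R e \<and> b \<in> nilpotents R \<and> e \<otimes>\<^bsub>R\<^esub> b = b \<otimes>\<^bsub>R\<^esub> e \<and> a = e \<oplus>\<^bsub>R\<^esub> b)"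

definition strongly_unit_nil_clean :: "('a, 'b) ring_scheme \<Rightarrow> bool" where
  "strongly_unit_nil_clean R \<longleftrightarrow>
     (\<forall>a\<in>carrier R. \<exists>u\<in>Units R. strongly_nil_clean_elem R (u \<otimes>\<^bsub>R\<^esub> a))"

(* In contrast to generate_ring of the library, the identity is not adjoined. *)
inductive_set generate_rng :: "('a, 'b) ring_scheme \<Rightarrow> 'a set \<Rightarrow> 'a set"
  for R and H where
    zero: "\<zero>\<^bsub>R\<^esub> \<in> generate_rng R H"
  | incl: "h \<in> H \<Longrightarrow> h \<in> generate_rng R H"
  | a_inv: "h \<in> generate_rng R H \<Longrightarrow> \<ominus>\<^bsub>R\<^esub> h \<in> generate_rng R H"
  | add: "\<lbrakk>h1 \<in> generate_rng R H; h2 \<in> generate_rng R H\<rbrakk> \<Longrightarrow> h1 \<oplus>\<^bsub>R\<^esub> h2 \<in> generate_rng R H"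
  | mult: "\<lbrakk>h1 \<in> generate_rng R H; h2 \<in> generate_rng R H\<rbrakk> \<Longrightarrow> h1 \<otimes>\<^bsub>R\<^esub> h2 \<in> generate_rng R H"

abbreviation list_product :: "('a, 'b) ring_scheme \<Rightarrow> 'a list \<Rightarrow> 'a" where
  "list_product R xs \<equiv> foldr (\<otimes>\<^bsub>R\<^esub>) xs \<one>\<^bsub>R\<^esub>"

(* S^k = 0 for some k, i.e. every product of k elements of S vanishes. *)
definition nilpotent_subrng :: "('a, 'b) ring_scheme \<Rightarrow> 'a set \<Rightarrow> bool" where
  "nilpotent_subrng R S \<longleftrightarrow>
     (\<exists>k. \<forall>xs. set xs \<subseteq> S \<and> length xs = k \<longrightarrow> list_product R xs = \<zero>\<^bsub>R\<^esub>)"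

definition locally_nilpotent_ideal :: "('a, 'b) ring_scheme \<Rightarrow> 'a set \<Rightarrow> bool" where
  "locally_nilpotent_ideal R I \<longleftrightarrow>
     ideal I R \<and> (\<forall>F. finite F \<and> F \<subseteq> I \<longrightarrow> nilpotent_subrng R (generate_rng R F))"

(* Greatest with respect to inclusion; it exists in every ring, see
   levitzki_radical_greatest below. *)
definition levitzki_radical :: "('a, 'b) ring_scheme \<Rightarrow> 'a set" where
  "levitzki_radical R = (GREATEST I. locally_nilpotent_ideal R I)"

definition weakly_2_primal :: "('a, 'b) ring_scheme \<Rightarrow> bool" where
  "weakly_2_primal R \<longleftrightarrow> nilpotents R = levitzki_radical R"

definition NI_ring :: "('a, 'b) ring_scheme \<Rightarrow> bool" where
  "NI_ring R \<longleftrightarrow> ideal (nilpotents R) R"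

(* Matrices are functions on {..<n} \<times> {..<n}, undefined outside this index set
   so that equality of matrices is equality of functions. *)
definition matrix_ring :: "('a, 'b) ring_scheme \<Rightarrow> nat \<Rightarrow> (nat \<times> nat \<Rightarrow> 'a) ring" where
  "matrix_ring R n =
     \<lparr>carrier = ({..<n} \<times> {..<n}) \<rightarrow>\<^sub>E carrier R,
      monoid.mult = (\<lambda>A B. \<lambda>(i, j)\<in>{..<n} \<times> {..<n}. \<Oplus>\<^bsub>R\<^esub>k\<in>{..<n}. A (i, k) \<otimes>\<^bsub>R\<^esub> B (k, j)),
      one = (\<lambda>(i, j)\<in>{..<n} \<times> {..<n}. if i = j then \<one>\<^bsub>R\<^esub> else \<zero>\<^bsub>R\<^esub>),
      ring.zero = (\<lambda>(i, j)\<in>{..<n} \<times> {..<n}. \<zero>\<^bsub>R\<^esub>),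
      ring.add = (\<lambda>A B. \<lambda>(i, j)\<in>{..<n} \<times> {..<n}. A (i, j) \<oplus>\<^bsub>R\<^esub> B (i, j))\<rparr>"

lemma (in ring) finsum_swap:
  assumes "finite A" "finite B" "\<And>i j. i \<in> A \<Longrightarrow> j \<in> B \<Longrightarrow> f i j \<in> carrier R"
  shows "(\<Oplus>i\<in>A. \<Oplus>j\<in>B. f i j) = (\<Oplus>j\<in>B. \<Oplus>i\<in>A. f i j)"
  using assms(1,3)
proof (induction A)
  case empty
  then show ?case by (simp add: finsum_zero)
next
  case (insert a A)
  have "(\<Oplus>i\<in>insert a A. \<Oplus>j\<in>B. f i j) = (\<Oplus>j\<in>B. f a j) \<oplus> (\<Oplus>i\<in>A. \<Oplus>j\<in>B. f i j)"
    using insert by (subst finsum_insert) auto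
  also have "\<dots> = (\<Oplus>j\<in>B. f a j) \<oplus> (\<Oplus>j\<in>B. \<Oplus>i\<in>A. f i j)"
    using insert by simp
  also have "\<dots> = (\<Oplus>j\<in>B. f a j \<oplus> (\<Oplus>i\<in>A. f i j))"
    using insert by (subst finsum_addf) auto
  also have "\<dots> = (\<Oplus>j\<in>B. \<Oplus>i\<in>insert a A. f i j)"
    using insert by (intro finsum_cong') (auto simp: finsum_insert Pi_def)
  finally show ?case .
qed

lemma (in ring) finsum_delta:
  assumes "finite A" "i \<in> A" "\<And>k. k \<in> A \<Longrightarrow> g k \<in> carrier R"
    and "\<And>k. k \<in> A \<Longrightarrow> f k = (if i = k then g k else \<zero>)"
  shows "finsum R f A = g i"
proof -
  have "finsum R f A = finsum R (\<lambda>k. if i = k then g k else \<zero>) A"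
    using assms by (intro finsum_cong') auto
  also have "\<dots> = g i" using assms by (intro finsum_singleton) auto
  finally show ?thesis .
qed

theorem (in ring) matrix_ring_is_ring: "ring (matrix_ring R n)"
proof (rule ringI)
  let ?M = "matrix_ring R n"
  let ?D = "{..<n} \<times> {..<n}"
  have ent: "A (i, j) \<in> carrier R" if "A \<in> carrier ?M" "i < n" "j < n" for A i j
    using that by (auto simp: matrix_ring_def PiE_iff)
  have eqI: "A = B" if "A \<in> carrier ?M" "B \<in> carrier ?M"
    "\<And>i j. i < n \<Longrightarrow> j < n \<Longrightarrow> A (i, j) = B (i, j)" for A B
    using that by (intro PiE_ext[of A ?D "\<lambda>_. carrier R" B]) (auto simp: matrix_ring_def)
  have addE: "(A \<oplus>\<^bsub>?M\<^esub> B) (i, j) = A (i, j) \<oplus> B (i, j)" if "i < n" "j < n" for A B i j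
    using that by (simp add: matrix_ring_def)
  have multE: "(A \<otimes>\<^bsub>?M\<^esub> B) (i, j) = (\<Oplus>k\<in>{..<n}. A (i, k) \<otimes> B (k, j))"
    if "i < n" "j < n" for A B i j
    using that by (simp add: matrix_ring_def)
  have oneE: "\<one>\<^bsub>?M\<^esub> (i, j) = (if i = j then \<one> else \<zero>)" if "i < n" "j < n" for i j
    using that by (simp add: matrix_ring_def)
  have zeroE: "\<zero>\<^bsub>?M\<^esub> (i, j) = \<zero>" if "i < n" "j < n" for i j
    using that by (simp add: matrix_ring_def)
  have addC: "A \<oplus>\<^bsub>?M\<^esub> B \<in> carrier ?M" if "A \<in> carrier ?M" "B \<in> carrier ?M" for A B
    using that ent by (fastforce simp: matrix_ring_def)
  have multC: "A \<otimes>\<^bsub>?M\<^esub> B \<in> carrier ?M" if "A \<in> carrier ?M" "B \<in> carrier ?M" for A B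
    using ent[OF that(1)] ent[OF that(2)] by (auto simp: matrix_ring_def intro!: finsum_closed)
  have oneC: "\<one>\<^bsub>?M\<^esub> \<in> carrier ?M" and zeroC: "\<zero>\<^bsub>?M\<^esub> \<in> carrier ?M"
    by (auto simp: matrix_ring_def)
  show "abelian_group ?M"
  proof (rule abelian_groupI)
    fix A assume A: "A \<in> carrier ?M"
    let ?B = "\<lambda>(i, j)\<in>?D. \<ominus> A (i, j)"
    have B: "?B \<in> carrier ?M" using ent[OF A] by (auto simp: matrix_ring_def)
    have "?B \<oplus>\<^bsub>?M\<^esub> A = \<zero>\<^bsub>?M\<^esub>"
      using A B ent[OF A] by (intro eqI addC zeroC) (auto simp: addE zeroE l_neg)
    with B show "\<exists>B\<in>carrier ?M. B \<oplus>\<^bsub>?M\<^esub> A = \<zero>\<^bsub>?M\<^esub>" by blast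
  qed (auto intro!: addC zeroC eqI simp: addE zeroE ent a_ac)
  show "monoid ?M"
  proof (rule monoidI)
    fix A B C assume A: "A \<in> carrier ?M" and B: "B \<in> carrier ?M" and C: "C \<in> carrier ?M"
    show "A \<otimes>\<^bsub>?M\<^esub> B \<otimes>\<^bsub>?M\<^esub> C = A \<otimes>\<^bsub>?M\<^esub> (B \<otimes>\<^bsub>?M\<^esub> C)"
    proof (rule eqI)
      fix i j assume i: "i < n" and j: "j < n"
      have e: "A (i, k) \<in> carrier R" "B (k, l) \<in> carrier R" "C (k, j) \<in> carrier R"
        if "k < n" "l < n" for k l
        using that i j A B C by (auto intro: ent)
      have l: "(A \<otimes>\<^bsub>?M\<^esub> B) (i, k) \<otimes> C (k, j) = (\<Oplus>l\<in>{..<n}. A (i, l) \<otimes> (B (l, k) \<otimes> C (k, j)))"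
        if k: "k < n" for k
      proof -
        have "(A \<otimes>\<^bsub>?M\<^esub> B) (i, k) \<otimes> C (k, j) = (\<Oplus>l\<in>{..<n}. (A (i, l) \<otimes> B (l, k)) \<otimes> C (k, j))"
          unfolding multE[OF i k] using k e by (intro finsum_ldistr) auto
        also have "\<dots> = (\<Oplus>l\<in>{..<n}. A (i, l) \<otimes> (B (l, k) \<otimes> C (k, j)))"
          using k e by (intro finsum_cong') (auto simp: m_assoc)
        finally show ?thesis .
      qed
      have r: "A (i, l) \<otimes> (B \<otimes>\<^bsub>?M\<^esub> C) (l, j) = (\<Oplus>k\<in>{..<n}. A (i, l) \<otimes> (B (l, k) \<otimes> C (k, j)))"
        if k: "l < n" for l
        unfolding multE[OF k j] using k e by (intro finsum_rdistr) auto
      have "(A \<otimes>\<^bsub>?M\<^esub> B \<otimes>\<^bsub>?M\<^esub> C) (i, j)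
          = (\<Oplus>k\<in>{..<n}. \<Oplus>l\<in>{..<n}. A (i, l) \<otimes> (B (l, k) \<otimes> C (k, j)))"
        unfolding multE[OF i j] using e l by (intro finsum_cong') auto
      also have "\<dots> = (\<Oplus>l\<in>{..<n}. \<Oplus>k\<in>{..<n}. A (i, l) \<otimes> (B (l, k) \<otimes> C (k, j)))"
        using e by (intro finsum_swap) auto
      also have "\<dots> = (A \<otimes>\<^bsub>?M\<^esub> (B \<otimes>\<^bsub>?M\<^esub> C)) (i, j)"
        unfolding multE[OF i j] using e r by (intro finsum_cong'[symmetric]) auto
      finally show "(A \<otimes>\<^bsub>?M\<^esub> B \<otimes>\<^bsub>?M\<^esub> C) (i, j) = (A \<otimes>\<^bsub>?M\<^esub> (B \<otimes>\<^bsub>?M\<^esub> C)) (i, j)" .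
    qed (auto intro!: multC A B C)
  next
    fix A assume A: "A \<in> carrier ?M"
    show "\<one>\<^bsub>?M\<^esub> \<otimes>\<^bsub>?M\<^esub> A = A"
    proof (rule eqI)
      fix i j assume "i < n" "j < n"
      then show "(\<one>\<^bsub>?M\<^esub> \<otimes>\<^bsub>?M\<^esub> A) (i, j) = A (i, j)"
        using ent[OF A] by (subst multE) (auto simp: oneE intro!: finsum_delta[where g = "\<lambda>k. A (k, j)"])
    qed (auto intro!: multC A oneC)
    show "A \<otimes>\<^bsub>?M\<^esub> \<one>\<^bsub>?M\<^esub> = A"
    proof (rule eqI)
      fix i j assume "i < n" "j < n"
      then show "(A \<otimes>\<^bsub>?M\<^esub> \<one>\<^bsub>?M\<^esub>) (i, j) = A (i, j)"
        using ent[OF A] by (subst multE) (auto simp: oneE intro!: finsum_delta[where g = "\<lambda>k. A (i, k)"])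
    qed (auto intro!: multC A oneC)
  qed (auto intro!: multC oneC)
  fix A B C assume A: "A \<in> carrier ?M" and B: "B \<in> carrier ?M" and C: "C \<in> carrier ?M"
  show "(A \<oplus>\<^bsub>?M\<^esub> B) \<otimes>\<^bsub>?M\<^esub> C = A \<otimes>\<^bsub>?M\<^esub> C \<oplus>\<^bsub>?M\<^esub> B \<otimes>\<^bsub>?M\<^esub> C"
  proof (rule eqI)
    fix i j assume i: "i < n" and j: "j < n"
    have e: "A (i, k) \<in> carrier R" "B (i, k) \<in> carrier R" "C (k, j) \<in> carrier R" if "k < n" for k
      using that i j A B C by (auto intro: ent)
    have "((A \<oplus>\<^bsub>?M\<^esub> B) \<otimes>\<^bsub>?M\<^esub> C) (i, j)
        = (\<Oplus>k\<in>{..<n}. A (i, k) \<otimes> C (k, j) \<oplus> B (i, k) \<otimes> C (k, j))"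
      unfolding multE[OF i j] using e i by (intro finsum_cong') (auto simp: addE l_distr)
    also have "\<dots> = (\<Oplus>k\<in>{..<n}. A (i, k) \<otimes> C (k, j)) \<oplus> (\<Oplus>k\<in>{..<n}. B (i, k) \<otimes> C (k, j))"
      using e by (intro finsum_addf) auto
    finally show "((A \<oplus>\<^bsub>?M\<^esub> B) \<otimes>\<^bsub>?M\<^esub> C) (i, j) = (A \<otimes>\<^bsub>?M\<^esub> C \<oplus>\<^bsub>?M\<^esub> B \<otimes>\<^bsub>?M\<^esub> C) (i, j)"
      by (simp add: addE multE i j)
  qed (auto intro!: multC addC A B C)
  show "C \<otimes>\<^bsub>?M\<^esub> (A \<oplus>\<^bsub>?M\<^esub> B) = C \<otimes>\<^bsub>?M\<^esub> A \<oplus>\<^bsub>?M\<^esub> C \<otimes>\<^bsub>?M\<^esub> B"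
  proof (rule eqI)
    fix i j assume i: "i < n" and j: "j < n"
    have e: "A (k, j) \<in> carrier R" "B (k, j) \<in> carrier R" "C (i, k) \<in> carrier R" if "k < n" for k
      using that i j A B C by (auto intro: ent)
    have "(C \<otimes>\<^bsub>?M\<^esub> (A \<oplus>\<^bsub>?M\<^esub> B)) (i, j)
        = (\<Oplus>k\<in>{..<n}. C (i, k) \<otimes> A (k, j) \<oplus> C (i, k) \<otimes> B (k, j))"
      unfolding multE[OF i j] using e j by (intro finsum_cong') (auto simp: addE r_distr)
    also have "\<dots> = (\<Oplus>k\<in>{..<n}. C (i, k) \<otimes> A (k, j)) \<oplus> (\<Oplus>k\<in>{..<n}. C (i, k) \<otimes> B (k, j))"
      using e by (intro finsum_addf) auto
    finally show "(C \<otimes>\<^bsub>?M\<^esub> (A \<oplus>\<^bsub>?M\<^esub> B)) (i, j) = (C \<otimes>\<^bsub>?M\<^esub> A \<oplus>\<^bsub>?M\<^esub> C \<otimes>\<^bsub>?M\<^esub> B) (i, j)"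
      by (simp add: addE multE i j)
  qed (auto intro!: multC addC A B C)
qed

context ring
begin

lemma list_product_closed: "set xs \<subseteq> carrier R \<Longrightarrow> list_product R xs \<in> carrier R"
  by (induction xs) auto

lemma list_product_append:
  "set xs \<subseteq> carrier R \<Longrightarrow> set ys \<subseteq> carrier R \<Longrightarrow>
     list_product R (xs @ ys) = list_product R xs \<otimes> list_product R ys"
  by (induction xs) (auto simp: m_assoc list_product_closed)

lemma generate_rng_closed:
  assumes "F \<subseteq> carrier R" "x \<in> generate_rng R F"
  shows "x \<in> carrier R"
  using assms(2) by induction (use assms(1) in auto)

lemma generate_rng_annihilates:
  assumes F: "F \<subseteq> carrier R" and "x \<in> generate_rng R F" and "z \<in> carrier R"
    and "\<And>w. set w \<subseteq> F \<Longrightarrow> Suc j \<le> length w \<Longrightarrow> list_product R w \<otimes> z = \<zero>"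
    and "set w \<subseteq> F" "j \<le> length w"
  shows "list_product R w \<otimes> (x \<otimes> z) = \<zero>"
  using assms(2-)
proof (induction arbitrary: z j w)
  case (zero z j w)
  then show ?case using F list_product_closed[of w] by auto
next
  case (incl h z j w)
  have w: "set w \<subseteq> carrier R" and h: "h \<in> carrier R" using F incl by auto
  have "list_product R w \<otimes> (h \<otimes> z) = list_product R (w @ [h]) \<otimes> z"
    using w h incl list_product_closed[OF w] by (subst list_product_append) (auto simp: m_assoc)
  also have "\<dots> = \<zero>" using incl by (intro incl.prems) auto
  finally show ?case .
next
  case (a_inv h z j w)
  have w: "set w \<subseteq> carrier R" using F a_inv by auto
  have h: "h \<in> carrier R" using a_inv generate_rng_closed[OF F] by auto
  have "list_product R w \<otimes> (h \<otimes> z) = \<zero>" by (rule a_inv.IH[OF a_inv.prems])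
  then show ?case using w h a_inv.prems list_product_closed[OF w] by (simp add: l_minus r_minus)
next
  case (add h1 h2 z j w)
  have w: "set w \<subseteq> carrier R" using F add by auto
  have h: "h1 \<in> carrier R" "h2 \<in> carrier R" using add generate_rng_closed[OF F] by auto
  have "list_product R w \<otimes> (h1 \<otimes> z) = \<zero>" by (rule add.IH(1)[OF add.prems])
  moreover have "list_product R w \<otimes> (h2 \<otimes> z) = \<zero>" by (rule add.IH(2)[OF add.prems])
  ultimately show ?case using w h add.prems list_product_closed[OF w] by (simp add: l_distr r_distr)
next
  case (mult h1 h2 z j w)
  have h: "h1 \<in> carrier R" "h2 \<in> carrier R" using mult generate_rng_closed[OF F] by auto
  have "list_product R w \<otimes> (h1 \<otimes> (h2 \<otimes> z)) = \<zero>"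
  proof (rule mult.IH(1))
    fix w' assume w': "set w' \<subseteq> F" "Suc j \<le> length w'"
    show "list_product R w' \<otimes> (h2 \<otimes> z) = \<zero>"
      by (rule mult.IH(2)[of z j w']) (use mult.prems w' in auto)
  qed (use h mult.prems in auto)
  then show ?case using h mult.prems by (simp add: m_assoc)
qed

lemma nilpotent_generate_rng_iff:
  assumes F: "F \<subseteq> carrier R"
  shows "nilpotent_subrng R (generate_rng R F) \<longleftrightarrow>
           (\<exists>k. \<forall>w. set w \<subseteq> F \<and> length w = k \<longrightarrow> list_product R w = \<zero>)"
proof
  assume "nilpotent_subrng R (generate_rng R F)"
  then show "\<exists>k. \<forall>w. set w \<subseteq> F \<and> length w = k \<longrightarrow> list_product R w = \<zero>"
    unfolding nilpotent_subrng_def by (meson generate_rng.incl subset_iff)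
next
  assume "\<exists>k. \<forall>w. set w \<subseteq> F \<and> length w = k \<longrightarrow> list_product R w = \<zero>"
  then obtain k where k: "\<And>w. set w \<subseteq> F \<Longrightarrow> length w = k \<Longrightarrow> list_product R w = \<zero>" by blast
  have k': "list_product R w = \<zero>" if w: "set w \<subseteq> F" "k \<le> length w" for w
  proof -
    have sub: "set (take k w) \<subseteq> F" "set (drop k w) \<subseteq> carrier R"
      using w F by (meson set_take_subset set_drop_subset subset_trans)+
    have "list_product R w = list_product R (take k w @ drop k w)" by simp
    also have "\<dots> = list_product R (take k w) \<otimes> list_product R (drop k w)"
      using sub F by (intro list_product_append) auto
    also have "\<dots> = \<zero>" using k[OF sub(1)] w list_product_closed[OF sub(2)] by simp
    finally show ?thesis .
  qed
  have main: "list_product R w \<otimes> list_product R xs = \<zero>"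
    if "set xs \<subseteq> generate_rng R F" "set w \<subseteq> F" "k \<le> length w + length xs" for xs w
    using that
  proof (induction xs arbitrary: w)
    case Nil
    have "list_product R w = \<zero>" using Nil by (intro k') auto
    then show ?case by simp
  next
    case (Cons x xs)
    have xs: "list_product R xs \<in> carrier R"
      using Cons generate_rng_closed[OF F] by (intro list_product_closed) auto
    have "list_product R w \<otimes> (x \<otimes> list_product R xs) = \<zero>"
      by (rule generate_rng_annihilates[OF F, where j = "length w"]) (use Cons xs in auto)
    then show ?case by simp
  qed
  have "list_product R xs = \<zero>" if "set xs \<subseteq> generate_rng R F" "length xs = k" for xs
  proof -
    have "list_product R xs \<in> carrier R"
      using that generate_rng_closed[OF F] by (intro list_product_closed) auto
    then show ?thesis using main[of xs "[]"] that by simp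
  qed
  then show "nilpotent_subrng R (generate_rng R F)" unfolding nilpotent_subrng_def by blast
qed

lemma locally_nilpotent_ideal_zero: "locally_nilpotent_ideal R {\<zero>}"
  unfolding locally_nilpotent_ideal_def
proof (intro conjI allI impI)
  fix F assume F: "finite F \<and> F \<subseteq> {\<zero>}"
  have "list_product R w = \<zero>" if "set w \<subseteq> F" "length w = 1" for w
    using that F by (auto simp: length_Suc_conv)
  then show "nilpotent_subrng R (generate_rng R F)"
    using F by (subst nilpotent_generate_rng_iff) auto
qed (rule zeroideal)

lemma locally_nilpotent_ideal_add:
  assumes I: "locally_nilpotent_ideal R I" and J: "locally_nilpotent_ideal R J"
  shows "locally_nilpotent_ideal R (I <+> J)"
  unfolding locally_nilpotent_ideal_def
proof (intro conjI allI impI)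
  have iI: "ideal I R" and iJ: "ideal J R" using I J by (auto simp: locally_nilpotent_ideal_def)
  interpret I: ideal I R by fact
  interpret J: ideal J R by fact
  show "ideal (I <+> J) R" by (rule add_ideals[OF iI iJ])
  fix F assume F: "finite F \<and> F \<subseteq> set_add R I J"
  then have "\<forall>x\<in>F. \<exists>a b. a \<in> I \<and> b \<in> J \<and> x = a \<oplus> b" by (force simp: set_add_def')
  then obtain a b where ab: "\<And>x. x \<in> F \<Longrightarrow> a x \<in> I \<and> b x \<in> J \<and> x = a x \<oplus> b x" by metis
  have Fc: "F \<subseteq> carrier R" using ab I.Icarr J.Icarr a_closed by (metis subsetI)
  have bc: "b ` F \<subseteq> carrier R" "b ` F \<subseteq> J" using ab J.Icarr by auto
  have "nilpotent_subrng R (generate_rng R (b ` F))"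
    using J F bc unfolding locally_nilpotent_ideal_def by blast
  then obtain m where m: "\<And>w. set w \<subseteq> b ` F \<Longrightarrow> length w = m \<Longrightarrow> list_product R w = \<zero>"
    using nilpotent_generate_rng_iff[OF bc(1)] by blast
  have diff: "\<exists>c\<in>I. list_product R w = c \<oplus> list_product R (map b w)" if "set w \<subseteq> F" for w
    using that
  proof (induction w)
    case Nil
    have "\<one> = \<zero> \<oplus> \<one>" by simp
    then show ?case using I.zero_closed by (intro bexI[of _ \<zero>]) auto
  next
    case (Cons x w)
    then obtain c where c: "c \<in> I" "list_product R w = c \<oplus> list_product R (map b w)" by auto
    let ?q = "list_product R (map b w)"
    have q: "?q \<in> carrier R" using Cons bc by (intro list_product_closed) auto
    have x: "a x \<in> I" "b x \<in> J" "x = a x \<oplus> b x" "x \<in> carrier R" using ab Cons Fc by auto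
    have cr: "a x \<in> carrier R" "b x \<in> carrier R" "c \<in> carrier R"
      using x c I.Icarr J.Icarr by auto
    have "list_product R (x # w) = x \<otimes> c \<oplus> (a x \<oplus> b x) \<otimes> ?q"
      using x c q cr by (simp add: r_distr)
    also have "\<dots> = (x \<otimes> c \<oplus> a x \<otimes> ?q) \<oplus> b x \<otimes> ?q"
      using x(4) q cr by (simp add: l_distr a_assoc)
    finally have "list_product R (x # w) = (x \<otimes> c \<oplus> a x \<otimes> ?q) \<oplus> list_product R (map b (x # w))"
      by simp
    moreover have "x \<otimes> c \<oplus> a x \<otimes> ?q \<in> I"
      using x c q by (intro I.a_closed I.I_l_closed I.I_r_closed) auto
    ultimately show ?case by blast
  qed
  define W where "W = list_product R ` {w. set w \<subseteq> F \<and> length w = m}"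
  have finW: "finite W" unfolding W_def using F by (intro finite_imageI finite_lists_length_eq) auto
  have WI: "W \<subseteq> I"
  proof
    fix y assume "y \<in> W"
    then obtain w where w: "set w \<subseteq> F" "length w = m" "y = list_product R w"
      by (auto simp: W_def)
    obtain c where c: "c \<in> I" "list_product R w = c \<oplus> list_product R (map b w)"
      using diff[OF w(1)] by blast
    have "list_product R (map b w) = \<zero>" using w by (intro m) auto
    then show "y \<in> I" using c w I.Icarr by simp
  qed
  have Wc: "W \<subseteq> carrier R" using WI I.Icarr by auto
  have "nilpotent_subrng R (generate_rng R W)"
    using I finW WI unfolding locally_nilpotent_ideal_def by blast
  then obtain k where k: "\<And>w. set w \<subseteq> W \<Longrightarrow> length w = k \<Longrightarrow> list_product R w = \<zero>"
    using nilpotent_generate_rng_iff[OF Wc] by blast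
  have chunk: "\<exists>v. set v \<subseteq> W \<and> length v = l \<and> list_product R w = list_product R v"
    if "set w \<subseteq> F" "length w = l * m" for l w
    using that
  proof (induction l arbitrary: w)
    case (Suc l)
    have sub: "set (take m w) \<subseteq> F" "set (drop m w) \<subseteq> F"
      using Suc.prems(1) by (meson set_take_subset set_drop_subset subset_trans)+
    obtain v where v: "set v \<subseteq> W" "length v = l" "list_product R (drop m w) = list_product R v"
      using Suc.IH[OF sub(2)] Suc.prems by auto
    have "list_product R w = list_product R (take m w @ drop m w)" by simp
    also have "\<dots> = list_product R (take m w) \<otimes> list_product R (drop m w)"
      using sub Fc by (intro list_product_append) auto
    finally have "list_product R w = list_product R (list_product R (take m w) # v)"
      using v by simp
    moreover have "list_product R (take m w) \<in> W"
      unfolding W_def using sub Suc.prems by (intro imageI) auto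
    ultimately show ?case using v by (intro exI[of _ "list_product R (take m w) # v"]) auto
  qed auto
  have "list_product R w = \<zero>" if "set w \<subseteq> F" "length w = k * m" for w
    using chunk[OF that] k by metis
  then show "nilpotent_subrng R (generate_rng R F)"
    using nilpotent_generate_rng_iff[OF Fc] by blast
qed

lemma locally_nilpotent_ideal_Union:
  "locally_nilpotent_ideal R (\<Union>{I. locally_nilpotent_ideal R I})"
    (is "locally_nilpotent_ideal R ?L")
proof -
  have ide: "ideal I R" if "locally_nilpotent_ideal R I" for I
    using that by (simp add: locally_nilpotent_ideal_def)
  have fin: "\<exists>I. locally_nilpotent_ideal R I \<and> F \<subseteq> I" if "finite F" "F \<subseteq> ?L" for F
    using that
  proof (induction F)
    case empty
    then show ?case using locally_nilpotent_ideal_zero by blast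
  next
    case (insert x F)
    then obtain I J where I: "locally_nilpotent_ideal R I" "F \<subseteq> I"
      and J: "locally_nilpotent_ideal R J" "x \<in> J" by auto
    have iI: "ideal I R" and iJ: "ideal J R" using ide I J by blast+
    have "I \<union> J \<subseteq> Idl (I \<union> J)"
      using ideal.Icarr[OF iI] ideal.Icarr[OF iJ] by (intro genideal_self) auto
    then have "I \<union> J \<subseteq> set_add R I J" using union_genideal[OF iI iJ] by simp
    then show ?case
      using locally_nilpotent_ideal_add[OF I(1) J(1)] I(2) J(2) by blast
  qed
  have pair: "\<exists>I. locally_nilpotent_ideal R I \<and> x \<in> I \<and> y \<in> I" if "x \<in> ?L" "y \<in> ?L" for x y
    using fin[of "{x, y}"] that by auto
  show ?thesis
  proof (rule locally_nilpotent_ideal_def[THEN iffD2], intro conjI allI impI)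
    show "ideal ?L R"
    proof (rule idealI[OF ring_axioms])
      show "subgroup ?L (add_monoid R)"
      proof (rule add.subgroupI)
        show "?L \<subseteq> carrier R" by (auto dest: ide ideal.Icarr)
        show "?L \<noteq> {}" using locally_nilpotent_ideal_zero by blast
        show "\<ominus> x \<in> ?L" if x: "x \<in> ?L" for x
        proof -
          obtain I where I: "locally_nilpotent_ideal R I" "x \<in> I" using x by blast
          interpret I: ideal I R by (rule ide[OF I(1)])
          show ?thesis using I I.a_inv_closed by blast
        qed
        show "x \<oplus> y \<in> ?L" if xy: "x \<in> ?L" "y \<in> ?L" for x y
        proof -
          obtain I where I: "locally_nilpotent_ideal R I" "x \<in> I" "y \<in> I" using pair[OF xy] by blast
          interpret I: ideal I R by (rule ide[OF I(1)])
          show ?thesis using I I.a_closed by blast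
        qed
      qed
      fix c x assume c: "c \<in> ?L" and x: "x \<in> carrier R"
      obtain I where I: "locally_nilpotent_ideal R I" "c \<in> I" using c by blast
      interpret I: ideal I R by (rule ide[OF I(1)])
      show "x \<otimes> c \<in> ?L" "c \<otimes> x \<in> ?L" using I x I.I_l_closed I.I_r_closed by blast+
    qed
    fix F assume F: "finite F \<and> F \<subseteq> ?L"
    then obtain I where "locally_nilpotent_ideal R I" "F \<subseteq> I" using fin by meson
    then show "nilpotent_subrng R (generate_rng R F)"
      using F by (simp add: locally_nilpotent_ideal_def)
  qed
qed

theorem levitzki_radical_greatest:
  "locally_nilpotent_ideal R (levitzki_radical R)"
  "locally_nilpotent_ideal R I \<Longrightarrow> I \<subseteq> levitzki_radical R"
proof -
  have "levitzki_radical R = \<Union>{I. locally_nilpotent_ideal R I}"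
    unfolding levitzki_radical_def
    using locally_nilpotent_ideal_Union by (intro Greatest_equality) auto
  then show "locally_nilpotent_ideal R (levitzki_radical R)"
    "locally_nilpotent_ideal R I \<Longrightarrow> I \<subseteq> levitzki_radical R"
    using locally_nilpotent_ideal_Union by auto
qed

end

end

theory Submission
  imports Defs "HOL-Combinatorics.Transposition"
begin

text \<open>Let $N$ be the set of nilpotents, an ideal in both parts, and $S = R/N$, a reduced ring. Units lift
  along surjections with nil kernel, and an element whose image is idempotent is strongly nil-clean.

  (1) In $S$ every element is a unit times a central idempotent. Splitting $S$ along such idempotents,
  Gaussian elimination brings a matrix over $S$ to an idempotent form, so that it is unit-regular and
  some unit multiple of it is idempotent. This lifts to $R$ because the kernel $\mathbb{M}_n(N)$ is nil:
  the entries of $A^k$ are sums of words of length $k$ in the finitely many entries of $A$.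

  (2) Let $a \in S$, let $U$ be a unit of $\mathbb{M}_n(S)$ and $X = U a I = E + B$ strongly nil-clean.
  Annihilators in the reduced ring $S$ are two-sided, so $X^2 Z = 0$ implies $X Z = 0$. Hence the
  nilpotent part $X(1-E)$ vanishes, $X = (1 + B) E$, and $aI = aI V aI$ with $V = (1 + B)^{-1} U$; an
  entry of this shows that $a$ is regular, hence a unit times an idempotent.\<close>

section \<open>Strongly nil-clean elements\<close>

text \<open>Local nilpotence serves part (1), where the entrywise map M_n(R) -> M_n(R/N) must have a
  nil kernel: whether M_n(N) is nil for every nil ideal N is equivalent to Koethe's conjecture. In
  part (2) matrices are only pushed down to R/N, and lifting takes place along R -> R/N, whose
  kernel is nil by construction; hence NI is enough. Elimination over S meets entries a that are
  neither zero nor invertible. If v a = e with a unit v and an idempotent e, then a becomes a unit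
  of the factor eS and zero in the factor (1-e)S, so splitting along e yields a pivot on one side
  and a new zero on the other. The obstacle in part (2) is that M_n(S) is not reduced for n > 1 and
  nonzero S, so the nilpotent part of a strongly nil-clean matrix may survive. Restricting to unit
  multiples of scalar matrices brings the annihilators back to S, entry by entry.\<close>

context cring
begin

text \<open>Multiplying the term \<open>a [^] k \<otimes> p'\<close> by
  \<open>a \<otimes> p \<oplus> b \<otimes> q = \<one>\<close> turns it into a multiple of the next
  power of \<open>a\<close> plus a multiple of \<open>b\<close>. Two applications make powers of
  both elements comaximal.\<close>

lemma comaximal_power:
  assumes "a \<in> carrier R" "b \<in> carrier R" "p \<in> carrier R" "q \<in> carrier R"
    and "a \<otimes> p \<oplus> b \<otimes> q = \<one>"
  shows "\<exists>p'\<in>carrier R. \<exists>q'\<in>carrier R. a [^] (k::nat) \<otimes> p' \<oplus> b \<otimes> q' = \<one>"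
proof (induction k)
  case 0
  show ?case using assms by (intro bexI[of _ \<one>] bexI[of _ \<zero>]) auto
next
  case (Suc k)
  then obtain p' q' where pq: "p' \<in> carrier R" "q' \<in> carrier R" "a [^] k \<otimes> p' \<oplus> b \<otimes> q' = \<one>"
    by blast
  have c: "a [^] k \<in> carrier R" using assms by simp
  have "a [^] Suc k \<otimes> (p \<otimes> p') \<oplus> b \<otimes> (q \<otimes> (a [^] k \<otimes> p') \<oplus> q')
      = (a [^] k \<otimes> p') \<otimes> (a \<otimes> p \<oplus> b \<otimes> q) \<oplus> b \<otimes> q'"
    using assms(1-4) pq(1,2) c by (simp only: nat_pow_Suc) algebra
  also have "\<dots> = \<one>" using assms pq c by simp
  finally show ?case using assms pq c by (intro bexI[of _ "p \<otimes> p'"] bexI[of _ "q \<otimes> (a [^] k \<otimes> p') \<oplus> q'"]) auto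
qed

text \<open>All mixed products contain s t = 0. The exponent is a successor because exponent 0 would
  give 1 = 1 + 1.\<close>

lemma orthogonal_add_power:
  assumes "s \<in> carrier R" "t \<in> carrier R" "s \<otimes> t = \<zero>"
  shows "(s \<oplus> t) [^] Suc k = s [^] Suc k \<oplus> t [^] Suc k"
proof (induction k)
  case (Suc k)
  have c: "s [^] k \<in> carrier R" "t [^] k \<in> carrier R" using assms by auto
  have "(s \<oplus> t) [^] Suc (Suc k) = (s [^] k \<otimes> s \<oplus> t [^] k \<otimes> t) \<otimes> (s \<oplus> t)"
    using Suc by simp
  also have "\<dots> = s [^] k \<otimes> s \<otimes> s \<oplus> t [^] k \<otimes> t \<otimes> t \<oplus> (s [^] k \<oplus> t [^] k) \<otimes> (s \<otimes> t)"
    using assms(1,2) c by algebra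
  also have "\<dots> = s [^] Suc (Suc k) \<oplus> t [^] Suc (Suc k)" using assms c by simp
  finally show ?case .
qed (use assms in simp)

text \<open>With y = 1 - x the product x y is nilpotent, so x^k y^k = 0 for some k, while x^k and
  y^k are comaximal. Hence 1 = f + e with e in (x^k), f in (y^k) and e f = 0, which makes e and f
  idempotent. The difference x - e = x f - y e is a sum of two orthogonal nilpotents.\<close>

lemma idempotent_near:
  assumes x: "x \<in> carrier R" and nil: "x \<otimes> x \<ominus> x \<in> nilpotents R"
  shows "\<exists>e. idempotent_elem R e \<and> x \<ominus> e \<in> nilpotents R"
proof -
  obtain m :: nat where m: "(x \<otimes> x \<ominus> x) [^] m = \<zero>" using nil by (auto simp: nilpotents_def)
  \<comment> \<open>A positive exponent is required for \<open>e [^] k = e\<close> and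
    \<open>f [^] k = f\<close> and for \<open>orthogonal_add_power\<close>.\<close>
  define k where "k = Suc m"
  define y where "y = \<one> \<ominus> x"
  have y: "y \<in> carrier R" using x by (simp add: y_def)
  have "(x \<otimes> x \<ominus> x) [^] k = \<zero>" using m x by (simp add: k_def)
  moreover have "x \<otimes> y = \<ominus> \<one> \<otimes> (x \<otimes> x \<ominus> x)" using x unfolding y_def by algebra
  ultimately have xyk: "x [^] k \<otimes> y [^] k = \<zero>"
    using x y by (simp add: nat_pow_distrib[symmetric] nat_pow_distrib[of "\<ominus> \<one>" "x \<otimes> x \<ominus> x"])
  have "x \<otimes> \<one> \<oplus> y \<otimes> \<one> = \<one>" using x unfolding y_def by algebra
  then obtain p1 q1 where 1: "p1 \<in> carrier R" "q1 \<in> carrier R" "x [^] k \<otimes> p1 \<oplus> y \<otimes> q1 = \<one>"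
    using comaximal_power[of x y \<one> \<one> k] x y by blast
  then have "y \<otimes> q1 \<oplus> x [^] k \<otimes> p1 = \<one>" using x y by (simp add: a_comm)
  then obtain q p where pq: "p \<in> carrier R" "q \<in> carrier R" "y [^] k \<otimes> q \<oplus> x [^] k \<otimes> p = \<one>"
    using comaximal_power[of y "x [^] k" q1 p1 k] x y 1 by blast
  have xk: "x [^] k \<in> carrier R" and yk: "y [^] k \<in> carrier R" using x y by auto
  define e where "e = x [^] k \<otimes> p"
  define f where "f = y [^] k \<otimes> q"
  have e: "e \<in> carrier R" and f: "f \<in> carrier R" using xk yk pq by (auto simp: e_def f_def)
  have fe1: "f \<oplus> e = \<one>" using pq by (simp add: e_def f_def)
  have "e \<otimes> f = (x [^] k \<otimes> y [^] k) \<otimes> (p \<otimes> q)"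
    using xk yk pq(1,2) unfolding e_def f_def by algebra
  then have ef: "e \<otimes> f = \<zero>" using xyk pq by simp
  have "e \<otimes> e = e \<otimes> (f \<oplus> e)" using e f ef by (simp add: r_distr)
  then have ide: "e \<otimes> e = e" using fe1 e by simp
  have "f \<otimes> f = f \<otimes> (f \<oplus> e)" using e f ef by (simp add: r_distr m_comm)
  then have idf: "f \<otimes> f = f" using fe1 f by simp
  have idk: "e [^] Suc j = e" "f [^] Suc j = f" for j
    by (induction j) (use e f ide idf in auto)
  have "x [^] k \<otimes> f = (x [^] k \<otimes> y [^] k) \<otimes> q" using xk yk pq(1,2) unfolding f_def by algebra
  then have xf: "(x \<otimes> f) [^] k = \<zero>"
    using xyk x pq f idk(2)[of m] nat_pow_distrib[of x f k] by (simp only: k_def[symmetric]) simp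
  have "y [^] k \<otimes> e = (x [^] k \<otimes> y [^] k) \<otimes> p" using xk yk pq(1,2) unfolding e_def by algebra
  then have ye0: "y [^] k \<otimes> e = \<zero>" using xyk pq by simp
  have "(\<ominus> y \<otimes> e) [^] k = (\<ominus> \<one>) [^] k \<otimes> (y [^] k \<otimes> e [^] k)"
    using y e nat_pow_distrib[of "\<ominus> \<one>" "y \<otimes> e" k] nat_pow_distrib[of y e k] by (simp add: l_minus)
  then have ye: "(\<ominus> y \<otimes> e) [^] k = \<zero>"
    using ye0 idk(1)[of m] by (simp only: k_def[symmetric]) simp
  have st: "(x \<otimes> f) \<otimes> (\<ominus> y \<otimes> e) = \<zero>"
  proof -
    have "(x \<otimes> f) \<otimes> (\<ominus> y \<otimes> e) = (\<ominus> y \<otimes> x) \<otimes> (e \<otimes> f)" using x y e f by algebra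
    then show ?thesis using ef x y by simp
  qed
  have "x \<ominus> e = x \<otimes> (f \<oplus> e) \<ominus> (x \<oplus> y) \<otimes> e"
  proof -
    have "x \<oplus> y = \<one>" using x unfolding y_def by algebra
    then show ?thesis using x e fe1 by simp
  qed
  also have "\<dots> = x \<otimes> f \<oplus> (\<ominus> y \<otimes> e)" using x y e f by algebra
  finally have "(x \<ominus> e) [^] k = \<zero>"
    using orthogonal_add_power[of "x \<otimes> f" "\<ominus> y \<otimes> e" m] xf ye st x y e f by (simp add: k_def[symmetric])
  then show ?thesis
    using ide e x by (intro exI[of _ e]) (auto simp: idempotent_elem_def nilpotents_def)
qed

end

section \<open>Idempotents, units and nilpotents in noncommutative rings\<close>

context ring
begin

text \<open>Idempotents can be split off inside a commutative subring that contains \<open>x\<close>.\<close>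

lemma bicommutant_subring:
  assumes "x \<in> carrier R"
  defines "C \<equiv> {z \<in> carrier R. \<forall>y\<in>carrier R. x \<otimes> y = y \<otimes> x \<longrightarrow> z \<otimes> y = y \<otimes> z}"
  shows "subring C R" "cring (R\<lparr>carrier := C\<rparr>)" "x \<in> C"
proof -
  have C: "z \<in> C \<longleftrightarrow> z \<in> carrier R \<and> (\<forall>y\<in>carrier R. x \<otimes> y = y \<otimes> x \<longrightarrow> z \<otimes> y = y \<otimes> z)" for z
    by (simp add: C_def)
  show s: "subring C R"
  proof (rule subringI)
    fix h1 h2 assume h: "h1 \<in> C" "h2 \<in> C"
    have "(h1 \<otimes> h2) \<otimes> y = y \<otimes> (h1 \<otimes> h2)" if y: "y \<in> carrier R" "x \<otimes> y = y \<otimes> x" for y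
    proof -
      have hc: "h1 \<in> carrier R" "h2 \<in> carrier R" "h1 \<otimes> y = y \<otimes> h1" "h2 \<otimes> y = y \<otimes> h2"
        using h y by (simp_all add: C)
      have "(h1 \<otimes> h2) \<otimes> y = (h1 \<otimes> y) \<otimes> h2" using hc(1,2,4) y(1) by (simp add: m_assoc)
      also have "\<dots> = y \<otimes> (h1 \<otimes> h2)" using hc y(1) by (simp flip: m_assoc)
      finally show ?thesis .
    qed
    then show "h1 \<otimes> h2 \<in> C" using h by (simp add: C)
    show "h1 \<oplus> h2 \<in> C" using h by (simp add: C l_distr r_distr)
  qed (auto simp: C l_minus r_minus)
  show "x \<in> C" using assms(1) by (simp add: C)
  have "h1 \<otimes> h2 = h2 \<otimes> h1" if h: "h1 \<in> C" "h2 \<in> C" for h1 h2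
  proof -
    \<comment> \<open>Since \<open>x\<close> commutes with itself, it is a test element for
      \<open>h2\<close>; therefore \<open>h2\<close> commutes with \<open>x\<close> and is in turn a
      test element for \<open>h1\<close>.\<close>
    have "h2 \<otimes> x = x \<otimes> h2" using h(2) assms(1) by (simp add: C)
    then have "x \<otimes> h2 = h2 \<otimes> x" by (rule sym)
    then show ?thesis using h by (simp add: C)
  qed
  then have "subcring C R" using s by (intro subcringI)
  then show "cring (R\<lparr>carrier := C\<rparr>)"
    using subcring_iff subringE(1)[OF s] by blast
qed

text \<open>\<open>idempotent_near\<close> is applied in the bicommutant of \<open>x\<close>. The
  idempotent it produces lies there too, so it commutes with the nilpotent remainder, as strong
  nil-cleanness demands.\<close>

lemma strongly_nil_clean_of_square:
  assumes x: "x \<in> carrier R" and nil: "x \<otimes> x \<ominus> x \<in> nilpotents R"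
  shows "strongly_nil_clean_elem R x"
proof -
  define C where "C = {z \<in> carrier R. \<forall>y\<in>carrier R. x \<otimes> y = y \<otimes> x \<longrightarrow> z \<otimes> y = y \<otimes> z}"
  let ?C = "R\<lparr>carrier := C\<rparr>"
  have sub: "subring C R" and xC: "x \<in> C"
    using bicommutant_subring[OF x] by (simp_all add: C_def)
  interpret C: cring ?C using bicommutant_subring[OF x] by (simp add: C_def)
  have pow: "y [^]\<^bsub>?C\<^esub> (k::nat) = y [^] k" for y k by (simp add: nat_pow_def)
  \<comment> \<open>Powers depend on multiplication and identity alone, but the additive inverse is
    defined by a choice inside the carrier; its agreement with that of \<open>R\<close> follows from
    uniqueness.\<close>
  have minus: "y \<ominus>\<^bsub>?C\<^esub> z = y \<ominus> z" if "y \<in> C" "z \<in> C" for y z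
  proof -
    have zc: "z \<in> carrier R" "\<ominus> z \<in> C" using that subringE(1,5)[OF sub] by auto
    have "\<ominus>\<^bsub>?C\<^esub> z = \<ominus> z" using C.minus_equality[of "\<ominus> z" z] that zc l_neg[of z] by simp
    then show ?thesis by (simp add: a_minus_def)
  qed
  have nilC: "y \<in> nilpotents ?C \<longleftrightarrow> y \<in> nilpotents R" if "y \<in> C" for y
    using that subringE(1)[OF sub] by (auto simp: nilpotents_def pow)
  have "x \<otimes> x \<ominus> x \<in> C"
    using xC subringE(5,6,7)[OF sub] by (simp add: a_minus_def)
  then have "x \<otimes>\<^bsub>?C\<^esub> x \<ominus>\<^bsub>?C\<^esub> x \<in> nilpotents ?C"
    using nil xC minus subringE(6)[OF sub] nilC by simp
  then obtain e where e: "idempotent_elem ?C e" "x \<ominus>\<^bsub>?C\<^esub> e \<in> nilpotents ?C"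
    using C.idempotent_near[of x] xC by auto
  then have eC: "e \<in> C" by (simp add: idempotent_elem_def)
  have ec: "e \<in> carrier R" using eC by (simp add: C_def)
  have xe: "x \<ominus> e \<in> C" using xC eC subringE(5,7)[OF sub] by (simp add: a_minus_def)
  have b: "x \<ominus> e \<in> nilpotents R" using e(2) minus[OF xC eC] nilC[OF xe] by simp
  have "e \<otimes> (x \<ominus> e) = (x \<ominus> e) \<otimes> e" using C.m_comm[of e "x \<ominus> e"] eC xe by simp
  moreover have "x = e \<oplus> (x \<ominus> e)" using x ec by algebra
  moreover have "idempotent_elem R e" using e(1) ec by (simp add: idempotent_elem_def)
  ultimately show ?thesis using b unfolding strongly_nil_clean_elem_def by blast
qed

text \<open>The witness is the geometric sum 1 + b + ... + b^(k-1). Carrying both products through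
  one induction gives a two-sided inverse when b^k = 0.\<close>

lemma one_minus_mult_geometric:
  assumes b: "b \<in> carrier R"
  shows "\<exists>c\<in>carrier R. (\<one> \<ominus> b) \<otimes> c = \<one> \<ominus> b [^] (k::nat) \<and> c \<otimes> (\<one> \<ominus> b) = \<one> \<ominus> b [^] k"
proof (induction k)
  case 0
  show ?case using b by (intro bexI[of _ \<zero>]) (auto simp: minus_eq r_neg)
next
  case (Suc k)
  then obtain c where c: "c \<in> carrier R" "(\<one> \<ominus> b) \<otimes> c = \<one> \<ominus> b [^] k"
    "c \<otimes> (\<one> \<ominus> b) = \<one> \<ominus> b [^] k" by blast
  have bk: "b [^] k \<in> carrier R" "b [^] k \<otimes> b \<in> carrier R" using b by auto
  have comm: "b \<otimes> b [^] k = b [^] k \<otimes> b" using b by (metis nat_pow_Suc nat_pow_Suc2)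
  have "(\<one> \<ominus> b) \<otimes> (c \<oplus> b [^] k) = (\<one> \<ominus> b [^] k) \<oplus> (b [^] k \<ominus> b [^] k \<otimes> b)"
    using b bk c comm by (simp add: r_distr) (simp add: minus_eq l_distr l_minus)
  moreover have "(c \<oplus> b [^] k) \<otimes> (\<one> \<ominus> b) = (\<one> \<ominus> b [^] k) \<oplus> (b [^] k \<ominus> b [^] k \<otimes> b)"
    using b bk c by (simp add: l_distr) (simp add: minus_eq r_distr r_minus)
  moreover have "(\<one> \<ominus> b [^] k) \<oplus> (b [^] k \<ominus> b [^] k \<otimes> b) = \<one> \<ominus> b [^] Suc k"
    using bk by (simp add: minus_eq a_assoc r_neg1 r_neg2)
  ultimately show ?case using c bk by (intro bexI[of _ "c \<oplus> b [^] k"]) auto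
qed

lemma one_minus_nilpotent_Unit:
  assumes "b \<in> nilpotents R"
  shows "\<one> \<ominus> b \<in> Units R"
proof -
  obtain k :: nat where k: "b \<in> carrier R" "b [^] k = \<zero>" using assms by (auto simp: nilpotents_def)
  then obtain c where "c \<in> carrier R" "(\<one> \<ominus> b) \<otimes> c = \<one>" "c \<otimes> (\<one> \<ominus> b) = \<one>"
    using one_minus_mult_geometric[of b k] by (auto simp: minus_eq)
  then show ?thesis using k by (auto simp: Units_def)
qed

lemma uminus_nilpotent:
  assumes "b \<in> nilpotents R"
  shows "\<ominus> b \<in> nilpotents R"
proof -
  obtain k :: nat where k: "b \<in> carrier R" "b [^] k = \<zero>" using assms by (auto simp: nilpotents_def)
  \<comment> \<open>The sign depends on the parity of \<open>j\<close>; the disjunction suffices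
    because either value vanishes with \<open>b [^] k\<close>.\<close>
  have "(\<ominus> b) [^] j = b [^] j \<or> (\<ominus> b) [^] j = \<ominus> (b [^] j)" for j :: nat
    by (induction j) (use k in \<open>auto simp: l_minus r_minus\<close>)
  from this[of k] show ?thesis using k by (auto simp: nilpotents_def)
qed

text \<open>The first product supplies a right inverse of \<open>u\<close>, the second a left
  inverse, and these must coincide. In \<open>Units_lift\<close> both products are known only modulo
  a nil kernel.\<close>

lemma Unit_of_left_right_Unit:
  assumes u: "u \<in> carrier R" and v: "v \<in> carrier R"
    and "u \<otimes> v \<in> Units R" "v \<otimes> u \<in> Units R"
  shows "u \<in> Units R"
proof -
  obtain p where p: "p \<in> carrier R" "(u \<otimes> v) \<otimes> p = \<one>" using assms(3) by (auto simp: Units_def)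
  obtain q where q: "q \<in> carrier R" "q \<otimes> (v \<otimes> u) = \<one>" using assms(4) by (auto simp: Units_def)
  have r: "u \<otimes> (v \<otimes> p) = \<one>" and l: "(q \<otimes> v) \<otimes> u = \<one>" using u v p q by (auto simp: m_assoc)
  have "q \<otimes> v = v \<otimes> p" by (rule inv_unique[OF l r]) (use u v p q in simp_all)
  then have l': "(v \<otimes> p) \<otimes> u = \<one>" using l by (rule subst)
  have c: "v \<otimes> p \<in> carrier R" using v p(1) by (rule m_closed)
  show ?thesis unfolding Units_def using u c r l' by blast
qed

end

section \<open>Transport along homomorphisms and lifting modulo a nil kernel\<close>

lemma (in ring_hom_ring) hom_nilpotent: "b \<in> nilpotents R \<Longrightarrow> h b \<in> nilpotents S"
  by (auto simp: nilpotents_def simp flip: hom_nat_pow) (metis hom_zero)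

lemma (in ring_hom_ring) hom_Units:
  assumes "u \<in> Units R"
  shows "h u \<in> Units S"
proof -
  obtain v where v: "u \<in> carrier R" "v \<in> carrier R" "v \<otimes> u = \<one>" "u \<otimes> v = \<one>"
    using assms by (auto simp: Units_def)
  then have "h v \<otimes>\<^bsub>S\<^esub> h u = \<one>\<^bsub>S\<^esub>" "h u \<otimes>\<^bsub>S\<^esub> h v = \<one>\<^bsub>S\<^esub>"
    by (simp_all flip: hom_mult)
  moreover have "h u \<in> carrier S" "h v \<in> carrier S" using v by auto
  ultimately show ?thesis unfolding Units_def by blast
qed

lemma (in ring_hom_ring) hom_strongly_nil_clean:
  assumes "strongly_nil_clean_elem R a"
  shows "strongly_nil_clean_elem S (h a)"
proof -
  obtain e b where eb: "idempotent_elem R e" "b \<in> nilpotents R" "e \<otimes> b = b \<otimes> e" "a = e \<oplus> b"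
    using assms by (auto simp: strongly_nil_clean_elem_def)
  have c: "e \<in> carrier R" "b \<in> carrier R" using eb by (auto simp: idempotent_elem_def nilpotents_def)
  have "idempotent_elem S (h e)" using eb(1) by (auto simp: idempotent_elem_def simp flip: hom_mult)
  moreover have "h e \<otimes>\<^bsub>S\<^esub> h b = h b \<otimes>\<^bsub>S\<^esub> h e" using eb(3) c by (simp flip: hom_mult)
  ultimately show ?thesis
    using hom_nilpotent[OF eb(2)] hom_add[OF c] unfolding strongly_nil_clean_elem_def eb(4) by blast
qed

lemma (in ring_hom_ring) hom_strongly_unit_nil_clean:
  assumes "strongly_unit_nil_clean R" and surj: "h ` carrier R = carrier S"
  shows "strongly_unit_nil_clean S"
  unfolding strongly_unit_nil_clean_def
proof
  fix s assume "s \<in> carrier S"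
  then obtain a where a: "a \<in> carrier R" "s = h a" using surj by blast
  then obtain u where u: "u \<in> Units R" "strongly_nil_clean_elem R (u \<otimes> a)"
    using assms(1) by (auto simp: strongly_unit_nil_clean_def)
  then have "strongly_nil_clean_elem S (h u \<otimes>\<^bsub>S\<^esub> s)"
    using hom_strongly_nil_clean[OF u(2)] a R.Units_closed by simp
  then show "\<exists>u\<in>Units S. strongly_nil_clean_elem S (u \<otimes>\<^bsub>S\<^esub> s)" using hom_Units[OF u(1)] by blast
qed

text \<open>It is instantiated twice for part (1): by the projection onto the quotient by the
  nilpotents and by the entrywise map it induces on matrices. Part (2) lifts along the projection
  alone.\<close>

locale nil_extension = ring_hom_ring +
  assumes surj: "h ` carrier R = carrier S"
    and nil_kernel: "\<And>x. x \<in> carrier R \<Longrightarrow> h x = \<zero>\<^bsub>S\<^esub> \<Longrightarrow> x \<in> nilpotents R"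
begin

text \<open>If \<open>v\<close> is any preimage of the inverse of \<open>h u\<close>, both products
  of \<open>u\<close> and \<open>v\<close> map to 1. They differ from 1 by a kernel element, and 1
  minus a nilpotent is a unit.\<close>

lemma Units_lift:
  assumes u: "u \<in> carrier R" and "h u \<in> Units S"
  shows "u \<in> Units R"
proof -
  obtain v' where v': "v' \<in> carrier S" "h u \<otimes>\<^bsub>S\<^esub> v' = \<one>\<^bsub>S\<^esub>" "v' \<otimes>\<^bsub>S\<^esub> h u = \<one>\<^bsub>S\<^esub>"
    using assms(2) by (auto simp: Units_def)
  obtain v where v: "v \<in> carrier R" "h v = v'" using v'(1) by (auto simp flip: surj)
  have unit: "x \<in> Units R" if x: "x \<in> carrier R" "h x = \<one>\<^bsub>S\<^esub>" for x
  proof -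
    have "\<one> \<ominus> x \<in> nilpotents R" using x by (intro nil_kernel) (auto simp: R.minus_eq S.r_neg)
    from R.one_minus_nilpotent_Unit[OF this] have "\<one> \<ominus> (\<one> \<ominus> x) \<in> Units R" .
    moreover have "\<one> \<ominus> (\<one> \<ominus> x) = x" using x by algebra
    ultimately show ?thesis by simp
  qed
  show ?thesis
    by (rule R.Unit_of_left_right_Unit[OF u v(1)]; rule unit) (use u v v' in simp_all)
qed

text \<open>Any preimage \<open>u\<close> of the unit of \<open>S\<close> is a unit, and the defect
  (u a)^2 - u a lies in the nil kernel. So an idempotent image is all that
  \<open>strongly_nil_clean_of_square\<close> asks for.\<close>

lemma strongly_unit_nil_clean_lift:
  assumes "\<And>s. s \<in> carrier S \<Longrightarrow> \<exists>u\<in>Units S. idempotent_elem S (u \<otimes>\<^bsub>S\<^esub> s)"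
  shows "strongly_unit_nil_clean R"
  unfolding strongly_unit_nil_clean_def
proof
  fix a assume a: "a \<in> carrier R"
  obtain u' where u': "u' \<in> Units S" "idempotent_elem S (u' \<otimes>\<^bsub>S\<^esub> h a)"
    using assms[OF hom_closed[OF a]] by blast
  obtain u where u: "u \<in> carrier R" "h u = u'" using S.Units_closed[OF u'(1)] by (auto simp flip: surj)
  have "(u \<otimes> a) \<otimes> (u \<otimes> a) \<ominus> (u \<otimes> a) \<in> nilpotents R"
    using u' u a by (intro nil_kernel) (auto simp: R.minus_eq S.r_neg idempotent_elem_def)
  then have "strongly_nil_clean_elem R (u \<otimes> a)"
    using u a by (intro R.strongly_nil_clean_of_square) auto
  then show "\<exists>u\<in>Units R. strongly_nil_clean_elem R (u \<otimes> a)" using Units_lift[of u] u u'(1) by blast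
qed

end

section \<open>Unit-regular elements and reduced rings\<close>

text \<open>This is equivalent to some unit multiple \<open>u \<otimes> a\<close> being idempotent,
  but treats left and right alike, so it can be tested after both row and column operations.\<close>

definition unit_regular_elem :: "('a, 'b) ring_scheme \<Rightarrow> 'a \<Rightarrow> bool" where
  "unit_regular_elem R a \<longleftrightarrow> a \<in> carrier R \<and> (\<exists>u\<in>Units R. a \<otimes>\<^bsub>R\<^esub> u \<otimes>\<^bsub>R\<^esub> a = a)"

context ring
begin

lemma unit_regular_elem_idempotent_mult:
  assumes "unit_regular_elem R a"
  shows "\<exists>u\<in>Units R. idempotent_elem R (u \<otimes> a)"
proof -
  obtain u where u: "u \<in> Units R" "a \<otimes> u \<otimes> a = a" and a: "a \<in> carrier R"
    using assms by (auto simp: unit_regular_elem_def)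
  have uc: "u \<in> carrier R" using u(1) by (rule Units_closed)
  have "(u \<otimes> a) \<otimes> (u \<otimes> a) = u \<otimes> (a \<otimes> u \<otimes> a)" using uc a by (simp add: m_assoc)
  then have "idempotent_elem R (u \<otimes> a)" using u(2) uc a by (simp add: idempotent_elem_def)
  then show ?thesis using u(1) by blast
qed

text \<open>If \<open>u\<close> serves for p b q, then q u p serves for b: the outer factors p and q
  cancel. This discards the row and column operations made during elimination.\<close>

lemma unit_regular_elem_equivalent:
  assumes b: "b \<in> carrier R" and p: "p \<in> Units R" and q: "q \<in> Units R"
    and "unit_regular_elem R (p \<otimes> b \<otimes> q)"
  shows "unit_regular_elem R b"
proof -
  have c: "p \<in> carrier R" "q \<in> carrier R" using p q by auto
  obtain u where u: "u \<in> Units R" "(p \<otimes> b \<otimes> q) \<otimes> u \<otimes> (p \<otimes> b \<otimes> q) = p \<otimes> b \<otimes> q"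
    using assms(4) by (auto simp: unit_regular_elem_def)
  have uc: "u \<in> carrier R" using u(1) by (rule Units_closed)
  have "p \<otimes> (b \<otimes> (q \<otimes> u \<otimes> p) \<otimes> b) \<otimes> q = p \<otimes> b \<otimes> q"
    using u(2) b c uc by (simp add: m_assoc)
  then have "(p \<otimes> (b \<otimes> (q \<otimes> u \<otimes> p) \<otimes> b) \<otimes> q) \<otimes> inv q = (p \<otimes> b \<otimes> q) \<otimes> inv q"
    by (rule arg_cong)
  then have "p \<otimes> (b \<otimes> (q \<otimes> u \<otimes> p) \<otimes> b) = p \<otimes> b"
    using b c uc q by (simp add: m_assoc)
  then have "b \<otimes> (q \<otimes> u \<otimes> p) \<otimes> b = b" using Units_l_cancel[OF p] b c uc by simp
  moreover have "q \<otimes> u \<otimes> p \<in> Units R" using p q u(1) by simp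
  ultimately show ?thesis using b by (auto simp: unit_regular_elem_def)
qed

lemma central_mult_mult:
  assumes "g \<in> carrier R" "h \<in> carrier R" "a \<in> carrier R" "b \<in> carrier R" "a \<otimes> h = h \<otimes> a"
  shows "(g \<otimes> a) \<otimes> (h \<otimes> b) = (g \<otimes> h) \<otimes> (a \<otimes> b)"
proof -
  have "(g \<otimes> a) \<otimes> (h \<otimes> b) = g \<otimes> (a \<otimes> h) \<otimes> b" using assms(1-4) by (simp add: m_assoc)
  also have "\<dots> = (g \<otimes> h) \<otimes> (a \<otimes> b)" unfolding assms(5) using assms(1-4) by (simp add: m_assoc)
  finally show ?thesis .
qed

text \<open>The cross terms carry the factor g h = 0, so multiplication is componentwise, as in a
  direct product of the factors cut out by g and h.\<close>

lemma orthogonal_central_mult: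
  assumes g: "g \<in> carrier R" "g \<otimes> g = g" "\<And>x. x \<in> carrier R \<Longrightarrow> x \<otimes> g = g \<otimes> x"
    and h: "h \<in> carrier R" "h \<otimes> h = h" "\<And>x. x \<in> carrier R \<Longrightarrow> x \<otimes> h = h \<otimes> x"
    and gh: "g \<otimes> h = \<zero>"
    and c: "a \<in> carrier R" "b \<in> carrier R" "c \<in> carrier R" "d \<in> carrier R"
  shows "(g \<otimes> a \<oplus> h \<otimes> b) \<otimes> (g \<otimes> c \<oplus> h \<otimes> d) = g \<otimes> (a \<otimes> c) \<oplus> h \<otimes> (b \<otimes> d)"
proof -
  have hg: "h \<otimes> g = \<zero>" using g(3)[OF h(1)] gh by simp
  have "(g \<otimes> a \<oplus> h \<otimes> b) \<otimes> (g \<otimes> c \<oplus> h \<otimes> d)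
      = ((g \<otimes> a) \<otimes> (g \<otimes> c) \<oplus> (g \<otimes> a) \<otimes> (h \<otimes> d)) \<oplus> ((h \<otimes> b) \<otimes> (g \<otimes> c) \<oplus> (h \<otimes> b) \<otimes> (h \<otimes> d))"
    using g(1) h(1) c by (simp add: l_distr r_distr a_ac)
  also have "(g \<otimes> a) \<otimes> (g \<otimes> c) = g \<otimes> (a \<otimes> c)"
    by (subst central_mult_mult) (simp_all only: g(1,2) g(3)[OF c(1)] c)
  also have "(g \<otimes> a) \<otimes> (h \<otimes> d) = \<zero>"
    by (subst central_mult_mult) (simp_all only: g(1) h(1) h(3)[OF c(1)] c gh m_closed l_null)
  also have "(h \<otimes> b) \<otimes> (g \<otimes> c) = \<zero>"
    by (subst central_mult_mult) (simp_all only: g(1) h(1) g(3)[OF c(2)] c hg m_closed l_null)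
  also have "(h \<otimes> b) \<otimes> (h \<otimes> d) = h \<otimes> (b \<otimes> d)"
    by (subst central_mult_mult) (simp_all only: h(1,2) h(3)[OF c(2)] c)
  finally show ?thesis using g(1) h(1) c by simp
qed

text \<open>The witnesses \<open>u\<close> and \<open>v\<close> are glued to g u + h v. It is
  invertible, with inverse glued from \<open>inv u\<close> and \<open>inv v\<close>, and acts like
  \<open>u\<close> on the g-component and like \<open>v\<close> on the h-component.\<close>

lemma unit_regular_elem_patch:
  assumes g: "g \<in> carrier R" "g \<otimes> g = g" "\<And>x. x \<in> carrier R \<Longrightarrow> x \<otimes> g = g \<otimes> x"
    and h: "h \<in> carrier R" "h \<otimes> h = h" "\<And>x. x \<in> carrier R \<Longrightarrow> x \<otimes> h = h \<otimes> x"
    and gh: "g \<otimes> h = \<zero>" "g \<oplus> h = \<one>" and a: "a \<in> carrier R"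
    and ga: "unit_regular_elem R (g \<otimes> a)" and ha: "unit_regular_elem R (h \<otimes> a)"
  shows "unit_regular_elem R a"
proof -
  note mult = orthogonal_central_mult[OF g h gh(1)]
  obtain u where u: "u \<in> Units R" "g \<otimes> a \<otimes> u \<otimes> (g \<otimes> a) = g \<otimes> a"
    using ga by (auto simp: unit_regular_elem_def)
  obtain v where v: "v \<in> Units R" "h \<otimes> a \<otimes> v \<otimes> (h \<otimes> a) = h \<otimes> a"
    using ha by (auto simp: unit_regular_elem_def)
  have c: "u \<in> carrier R" "v \<in> carrier R" "inv u \<in> carrier R" "inv v \<in> carrier R" using u v by auto
  have split: "g \<otimes> x \<oplus> h \<otimes> x = x" if "x \<in> carrier R" for x
    using that gh(2) g(1) h(1) by (simp flip: l_distr)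
  define w where "w = g \<otimes> u \<oplus> h \<otimes> v"
  define w' where "w' = g \<otimes> inv u \<oplus> h \<otimes> inv v"
  have wc: "w \<in> carrier R" "w' \<in> carrier R" using c g(1) h(1) by (auto simp: w_def w'_def)
  have "w \<otimes> w' = \<one>" "w' \<otimes> w = \<one>"
    unfolding w_def w'_def using mult c u(1) v(1) split[OF one_closed] by simp_all
  then have "w \<in> Units R" using wc unfolding Units_def by blast
  moreover have "a \<otimes> w \<otimes> a = a"
  proof -
    have "a \<otimes> w \<otimes> a = ((g \<otimes> a \<oplus> h \<otimes> a) \<otimes> (g \<otimes> u \<oplus> h \<otimes> v)) \<otimes> (g \<otimes> a \<oplus> h \<otimes> a)"
      by (simp add: split[OF a] w_def)
    also have "\<dots> = g \<otimes> (a \<otimes> u \<otimes> a) \<oplus> h \<otimes> (a \<otimes> v \<otimes> a)" using mult a c by simp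
    also have "g \<otimes> (a \<otimes> u \<otimes> a) = g \<otimes> a \<otimes> u \<otimes> (g \<otimes> a)"
      using central_mult_mult[OF g(1) g(1) _ a, of "a \<otimes> u"] g(1,2) g(3)[of "a \<otimes> u"] a c by (simp add: m_assoc)
    also have "h \<otimes> (a \<otimes> v \<otimes> a) = h \<otimes> a \<otimes> v \<otimes> (h \<otimes> a)"
      using central_mult_mult[OF h(1) h(1) _ a, of "a \<otimes> v"] h(1,2) h(3)[of "a \<otimes> v"] a c by (simp add: m_assoc)
    also have "g \<otimes> a \<otimes> u \<otimes> (g \<otimes> a) \<oplus> h \<otimes> a \<otimes> v \<otimes> (h \<otimes> a) = a"
      unfolding u(2) v(2) by (rule split[OF a])
    finally show ?thesis .
  qed
  ultimately show ?thesis using a unfolding unit_regular_elem_def by blast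
qed

end

section \<open>Reduced rings\<close>

locale reduced_ring = ring +
  assumes square_zero: "\<lbrakk>x \<in> carrier R; x \<otimes> x = \<zero>\<rbrakk> \<Longrightarrow> x = \<zero>"
begin

lemma nilpotent_zero:
  assumes "x \<in> nilpotents R"
  shows "x = \<zero>"
proof -
  obtain k :: nat where "x \<in> carrier R" "x [^] k = \<zero>" using assms by (auto simp: nilpotents_def)
  then show ?thesis
  proof (induction k rule: less_induct)
    case (less k)
    show ?case
    proof (cases "k \<le> 1")
      case True
      show ?thesis
      proof (cases k)
        case 0
        \<comment> \<open>Exponent 0 is possible only in the trivial ring, where the claim still
          holds.\<close>
        then have "\<one> = \<zero>" using less.prems by simp
        then have "carrier R = {\<zero>}" by (rule one_zeroD)
          then show ?thesis using less.prems(1) by simp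
      next
        case (Suc j)
        then show ?thesis using True less.prems by simp
      qed
    next
      case False
      \<comment> \<open>For k > 1 one has 2(k-1) \<ge> k, so x^(k-1) has square zero and the
        exponent descends.\<close>
      define j where "j = k - 1"
      have "j + j = k + (k - 2)" using False by (simp add: j_def)
      then have "x [^] j \<otimes> x [^] j = x [^] (k + (k - 2))" using less.prems(1) by (simp only: nat_pow_mult)
      also have "\<dots> = x [^] k \<otimes> x [^] (k - 2)" using less.prems(1) by (simp add: nat_pow_mult)
      also have "\<dots> = \<zero>" using less.prems by simp
      finally have "x [^] j = \<zero>" using less.prems(1) square_zero[of "x [^] j"] by simp
      then show ?thesis using less.IH[of j] False less.prems(1) by (simp add: j_def)
    qed
  qed
qed

lemma mult_zero_comm:
  assumes "x \<in> carrier R" "y \<in> carrier R" "x \<otimes> y = \<zero>"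
  shows "y \<otimes> x = \<zero>"
proof -
  have "(y \<otimes> x) \<otimes> (y \<otimes> x) = y \<otimes> (x \<otimes> y) \<otimes> x" using assms(1,2) by (simp add: m_assoc)
  then show ?thesis using assms square_zero[of "y \<otimes> x"] by simp
qed

text \<open>The square of x r y contains the factor y x, which vanishes together with x y. Thus
  annihilators in a reduced ring are two-sided ideals, which drives all later uses of
  reducedness.\<close>

lemma mult_zero_insert:
  assumes "x \<in> carrier R" "y \<in> carrier R" "r \<in> carrier R" "x \<otimes> y = \<zero>"
  shows "x \<otimes> (r \<otimes> y) = \<zero>"
proof -
  have "(x \<otimes> (r \<otimes> y)) \<otimes> (x \<otimes> (r \<otimes> y)) = x \<otimes> r \<otimes> (y \<otimes> x) \<otimes> (r \<otimes> y)"
    using assms(1-3) by (simp add: m_assoc)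
  then show ?thesis
    using assms(1-3) mult_zero_comm[OF assms(1,2,4)] square_zero[of "x \<otimes> (r \<otimes> y)"] by simp
qed

text \<open>Since e(1-e) = 0 and (1-e)e = 0, inserting x gives e x (1-e) = 0 and (1-e) x e = 0: both
  off-diagonal Peirce components of x vanish.\<close>

lemma idempotent_central:
  assumes e: "e \<in> carrier R" "e \<otimes> e = e" and x: "x \<in> carrier R"
  shows "x \<otimes> e = e \<otimes> x"
proof -
  have f: "\<one> \<ominus> e \<in> carrier R" using e by simp
  have 1: "e \<otimes> (\<one> \<ominus> e) = \<zero>" using e by (simp add: minus_eq r_distr r_minus r_neg)
  have 2: "(\<one> \<ominus> e) \<otimes> e = \<zero>" using e by (simp add: minus_eq l_distr l_minus r_neg)
  have "e \<otimes> x \<ominus> e \<otimes> x \<otimes> e = e \<otimes> (x \<otimes> (\<one> \<ominus> e))"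
    using e(1) x by (simp add: minus_eq r_distr r_minus m_assoc)
  also have "\<dots> = \<zero>" by (rule mult_zero_insert[OF e(1) f x 1])
  finally have 3: "e \<otimes> x = e \<otimes> x \<otimes> e" using e(1) x by simp
  have "x \<otimes> e \<ominus> e \<otimes> x \<otimes> e = (\<one> \<ominus> e) \<otimes> (x \<otimes> e)"
    using e(1) x by (simp add: minus_eq l_distr l_minus m_assoc)
  also have "\<dots> = \<zero>" by (rule mult_zero_insert[OF f e(1) x 2])
  finally have "x \<otimes> e = e \<otimes> x \<otimes> e" using e(1) x by simp
  from trans[OF this 3[symmetric]] show ?thesis .
qed

text \<open>The idempotents e = a z and f = z a are central and therefore equal. Then y = e z
  inverts a inside the factor cut out by e, and adding h = 1 - e makes both invertible in the whole
  ring: y + h is the inverse of a + h, and (y + h) a = e.\<close>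

lemma regular_imp_idempotent_multiple:
  assumes a: "a \<in> carrier R" and z: "z \<in> carrier R" and "a \<otimes> z \<otimes> a = a"
  shows "\<exists>u\<in>Units R. idempotent_elem R (u \<otimes> a)"
proof -
  define e where "e = a \<otimes> z"
  have e: "e \<in> carrier R" using a z by (simp add: e_def)
  have ea: "e \<otimes> a = a" using assms(3) by (simp add: e_def)
  have ee: "e \<otimes> e = e"
  proof -
    have "e \<otimes> e = (e \<otimes> a) \<otimes> z" using a z e by (simp add: e_def m_assoc)
    then show ?thesis unfolding ea by (simp add: e_def)
  qed
  note ce = idempotent_central[OF e ee]
  define f where "f = z \<otimes> a"
  have f: "f \<in> carrier R" using a z by (simp add: f_def)
  have af: "a \<otimes> f = a" using assms(3) a z by (simp add: f_def m_assoc)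
  have ff: "f \<otimes> f = f"
  proof -
    have "f \<otimes> f = z \<otimes> (a \<otimes> f)" using a z f by (simp add: f_def m_assoc)
    then show ?thesis unfolding af by (simp add: f_def)
  qed
  note cf = idempotent_central[OF f ff]
  \<comment> \<open>By centrality each of \<open>e\<close> and \<open>f\<close> equals e f.\<close>
  have "e = (a \<otimes> f) \<otimes> z" unfolding af by (simp add: e_def)
  also have "\<dots> = e \<otimes> f" using cf[OF z] a z f by (simp add: e_def m_assoc)
  finally have 1: "e = e \<otimes> f" .
  have "f = z \<otimes> (e \<otimes> a)" unfolding ea by (simp add: f_def)
  also have "\<dots> = (z \<otimes> e) \<otimes> a" using a z e by (simp add: m_assoc)
  also have "\<dots> = e \<otimes> f" unfolding ce[OF z] using a z e by (simp add: f_def m_assoc)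
  finally have "e = f" using 1 by simp
  then have za: "z \<otimes> a = e" by (simp add: f_def)
  have ae: "a \<otimes> e = a" using ea ce[OF a] by simp
  define y where "y = e \<otimes> z"
  have y: "y \<in> carrier R" using e z by (simp add: y_def)
  have ey: "e \<otimes> y = y" unfolding y_def m_assoc[OF e e z, symmetric] ee ..
  have ya: "y \<otimes> a = e" unfolding y_def m_assoc[OF e z a] za by (rule ee)
  have ay: "a \<otimes> y = e" unfolding y_def m_assoc[OF a e z, symmetric] ae by (simp add: e_def)
  define h where "h = \<one> \<ominus> e"
  have h: "h \<in> carrier R" using e by (simp add: h_def)
  have he: "h \<otimes> e = \<zero>" using e ee by (simp add: h_def minus_eq l_distr l_minus r_neg)
  have hh: "h \<otimes> h = h"
    using he h e by (subst (2) h_def) (simp add: minus_eq r_distr r_minus)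
  have eh: "e \<oplus> h = \<one>" using e unfolding h_def by algebra
  have hx: "h \<otimes> x = \<zero>" "x \<otimes> h = \<zero>" if x: "x \<in> carrier R" "e \<otimes> x = x" for x
  proof -
    have "h \<otimes> (e \<otimes> x) = \<zero>" using he h e x(1) by (simp flip: m_assoc)
    then show "h \<otimes> x = \<zero>" unfolding x(2) .
    then show "x \<otimes> h = \<zero>" using mult_zero_comm h x(1) by simp
  qed
  have "(y \<oplus> h) \<otimes> (a \<oplus> h) = y \<otimes> a \<oplus> y \<otimes> h \<oplus> (h \<otimes> a \<oplus> h \<otimes> h)"
    using y h a by (simp add: l_distr r_distr a_ac)
  then have 1: "(y \<oplus> h) \<otimes> (a \<oplus> h) = \<one>"
    using hx[OF a ea] hx[OF y ey] ya hh eh e h by simp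
  have "(a \<oplus> h) \<otimes> (y \<oplus> h) = a \<otimes> y \<oplus> a \<otimes> h \<oplus> (h \<otimes> y \<oplus> h \<otimes> h)"
    using y h a by (simp add: l_distr r_distr a_ac)
  then have 2: "(a \<oplus> h) \<otimes> (y \<oplus> h) = \<one>"
    using hx[OF a ea] hx[OF y ey] ay hh eh e h by simp
  have "y \<oplus> h \<in> Units R" using 1 2 a_closed[OF y h] a_closed[OF a h] unfolding Units_def by blast
  moreover have "(y \<oplus> h) \<otimes> a = e" using y h a ya hx[OF a ea] e by (simp add: l_distr)
  ultimately show ?thesis using e ee unfolding idempotent_elem_def by metis
qed

lemma strongly_nil_clean_idempotent:
  assumes "strongly_nil_clean_elem R a"
  shows "idempotent_elem R a"
proof -
  obtain e b where "idempotent_elem R e" "b \<in> nilpotents R" "a = e \<oplus> b"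
    using assms by (auto simp: strongly_nil_clean_elem_def)
  moreover from this have "b = \<zero>" by (intro nilpotent_zero)
  ultimately show ?thesis by (simp add: idempotent_elem_def)
qed

end

section \<open>The quotient by the ideal of nilpotents\<close>

context ring
begin

lemma coset_zero_iff:
  assumes "ideal I R" "x \<in> carrier R"
  shows "I +> x = \<zero>\<^bsub>R Quot I\<^esub> \<longleftrightarrow> x \<in> I"
  using assms ideal.rcos_const_imp_mem[OF assms(1)] a_rcos_zero[OF assms(1)]
  by (auto simp: FactRing_def)

lemma carrier_quotient: "carrier (R Quot I) = (+>) I ` carrier R"
  by (auto simp: FactRing_def A_RCOSETS_def')

lemma quotient_nilpotents_reduced:
  assumes N: "ideal (nilpotents R) R"
  shows "reduced_ring (R Quot (nilpotents R))"
proof -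
  let ?N = "nilpotents R"
  interpret Q: ring_hom_ring R "R Quot ?N" "(+>) ?N"
    using ideal.rcos_ring_hom_ring[OF N] .
  have "s = \<zero>\<^bsub>R Quot ?N\<^esub>"
    if s: "s \<in> carrier (R Quot ?N)" "s \<otimes>\<^bsub>R Quot ?N\<^esub> s = \<zero>\<^bsub>R Quot ?N\<^esub>" for s
  proof -
    obtain x where x: "x \<in> carrier R" "s = ?N +> x" using s(1) unfolding carrier_quotient by blast
    have "?N +> (x \<otimes> x) = \<zero>\<^bsub>R Quot ?N\<^esub>"
      using s(2) unfolding x(2) Q.hom_mult[OF x(1) x(1)] .
    then have "x \<otimes> x \<in> ?N" using coset_zero_iff[OF N m_closed[OF x(1) x(1)]] by blast
    then obtain k :: nat where "(x \<otimes> x) [^] k = \<zero>" by (auto simp: nilpotents_def)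
    moreover have "(x \<otimes> x) [^] k = x [^] (2 * k)"
      using x(1) nat_pow_pow[of x 2 k] by (simp add: numeral_2_eq_2)
    ultimately have "x \<in> ?N" using x(1) by (auto simp: nilpotents_def)
    then show ?thesis unfolding x(2) using coset_zero_iff[OF N x(1)] by simp
  qed
  then show ?thesis by (intro reduced_ring.intro reduced_ring_axioms.intro Q.S.ring_axioms)
qed

lemma quotient_nilpotents_nil_extension:
  assumes N: "ideal (nilpotents R) R"
  shows "nil_extension R (R Quot (nilpotents R)) ((+>) (nilpotents R))"
  by (intro nil_extension.intro nil_extension_axioms.intro ideal.rcos_ring_hom_ring[OF N])
    (simp_all add: carrier_quotient coset_zero_iff[OF N])

end

section \<open>Matrices\<close>

definition mat :: "nat \<Rightarrow> (nat \<Rightarrow> nat \<Rightarrow> 'a) \<Rightarrow> nat \<times> nat \<Rightarrow> 'a" where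
  "mat n f = (\<lambda>(i, j)\<in>{..<n} \<times> {..<n}. f i j)"

lemma mat_entry [simp]: "i < n \<Longrightarrow> j < n \<Longrightarrow> mat n f (i, j) = f i j"
  by (simp add: mat_def)

lemma mat_carrier:
  "(\<And>i j. i < n \<Longrightarrow> j < n \<Longrightarrow> f i j \<in> carrier R) \<Longrightarrow> mat n f \<in> carrier (matrix_ring R n)"
  by (auto simp: mat_def matrix_ring_def)

lemma matrix_entry_carrier:
  "A \<in> carrier (matrix_ring R n) \<Longrightarrow> i < n \<Longrightarrow> j < n \<Longrightarrow> A (i, j) \<in> carrier R"
  by (auto simp: matrix_ring_def PiE_iff)

lemma matrix_entries_subset:
  "A \<in> carrier (matrix_ring R n) \<Longrightarrow> A ` ({..<n} \<times> {..<n}) \<subseteq> carrier R"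
  by (auto simp: matrix_ring_def PiE_iff)

lemma matrix_eqI:
  assumes "A \<in> carrier (matrix_ring R n)" "B \<in> carrier (matrix_ring R n)"
    and "\<And>i j. i < n \<Longrightarrow> j < n \<Longrightarrow> A (i, j) = B (i, j)"
  shows "A = B"
  using assms by (intro PiE_ext[of A "{..<n} \<times> {..<n}" "\<lambda>_. carrier R" B]) (auto simp: matrix_ring_def)

lemma matrix_add_entry:
  "i < n \<Longrightarrow> j < n \<Longrightarrow> (A \<oplus>\<^bsub>matrix_ring R n\<^esub> B) (i, j) = A (i, j) \<oplus>\<^bsub>R\<^esub> B (i, j)"
  by (simp add: matrix_ring_def)

lemma matrix_mult_entry:
  "i < n \<Longrightarrow> j < n \<Longrightarrow>
     (A \<otimes>\<^bsub>matrix_ring R n\<^esub> B) (i, j) = (\<Oplus>\<^bsub>R\<^esub>k\<in>{..<n}. A (i, k) \<otimes>\<^bsub>R\<^esub> B (k, j))"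
  by (simp add: matrix_ring_def)

lemma matrix_one_entry:
  "i < n \<Longrightarrow> j < n \<Longrightarrow> \<one>\<^bsub>matrix_ring R n\<^esub> (i, j) = (if i = j then \<one>\<^bsub>R\<^esub> else \<zero>\<^bsub>R\<^esub>)"
  by (simp add: matrix_ring_def)

lemma matrix_zero_entry: "i < n \<Longrightarrow> j < n \<Longrightarrow> \<zero>\<^bsub>matrix_ring R n\<^esub> (i, j) = \<zero>\<^bsub>R\<^esub>"
  by (simp add: matrix_ring_def)

section \<open>Scalar matrices, elimination matrices and nilpotent matrices\<close>

definition scalar_mat :: "('a, 'b) ring_scheme \<Rightarrow> nat \<Rightarrow> 'a \<Rightarrow> nat \<times> nat \<Rightarrow> 'a" where
  "scalar_mat R n a = mat n (\<lambda>i j. if i = j then a else \<zero>\<^bsub>R\<^esub>)"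

definition swap_mat :: "('a, 'b) ring_scheme \<Rightarrow> nat \<Rightarrow> nat \<Rightarrow> nat \<Rightarrow> nat \<times> nat \<Rightarrow> 'a" where
  "swap_mat R n r s = mat n (\<lambda>i j. if transpose r s i = j then \<one>\<^bsub>R\<^esub> else \<zero>\<^bsub>R\<^esub>)"

text \<open>Multiplication from the left scales row k by x_k and adds multiples of the old row k to
  all other rows at once, so a whole column is cleared in one operation.\<close>

definition column_mat :: "('a, 'b) ring_scheme \<Rightarrow> nat \<Rightarrow> nat \<Rightarrow> (nat \<Rightarrow> 'a) \<Rightarrow> nat \<times> nat \<Rightarrow> 'a" where
  "column_mat R n k x = mat n (\<lambda>i j. if j = k then x i else if i = j then \<one>\<^bsub>R\<^esub> else \<zero>\<^bsub>R\<^esub>)"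

lemma transpose_less: "r < n \<Longrightarrow> s < n \<Longrightarrow> i < n \<Longrightarrow> transpose r s i < (n::nat)"
  by (auto simp: transpose_def)

context ring
begin

lemma scalar_mat_carrier: "a \<in> carrier R \<Longrightarrow> scalar_mat R n a \<in> carrier (matrix_ring R n)"
  by (auto simp: scalar_mat_def intro: mat_carrier)

lemma scalar_mat_mult_entry:
  assumes "a \<in> carrier R" "A \<in> carrier (matrix_ring R n)" "i < n" "j < n"
  shows "(scalar_mat R n a \<otimes>\<^bsub>matrix_ring R n\<^esub> A) (i, j) = a \<otimes> A (i, j)"
  unfolding matrix_mult_entry[OF assms(3,4)]
  by (rule finsum_delta[where g = "\<lambda>k. a \<otimes> A (k, j)"])
    (use assms in \<open>auto simp: scalar_mat_def matrix_entry_carrier\<close>)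

lemma mult_scalar_mat_entry:
  assumes "a \<in> carrier R" "A \<in> carrier (matrix_ring R n)" "i < n" "j < n"
  shows "(A \<otimes>\<^bsub>matrix_ring R n\<^esub> scalar_mat R n a) (i, j) = A (i, j) \<otimes> a"
  unfolding matrix_mult_entry[OF assms(3,4)]
  by (rule finsum_delta[where g = "\<lambda>k. A (i, k) \<otimes> a"])
    (use assms in \<open>auto simp: scalar_mat_def matrix_entry_carrier\<close>)

lemma swap_mat_carrier: "swap_mat R n r s \<in> carrier (matrix_ring R n)"
  by (auto simp: swap_mat_def intro: mat_carrier)

lemma swap_mat_mult_entry:
  assumes "r < n" "s < n" "A \<in> carrier (matrix_ring R n)" "i < n" "j < n"
  shows "(swap_mat R n r s \<otimes>\<^bsub>matrix_ring R n\<^esub> A) (i, j) = A (transpose r s i, j)"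
  unfolding matrix_mult_entry[OF assms(4,5)]
  by (rule finsum_delta[where g = "\<lambda>k. A (k, j)"])
    (use assms in \<open>auto simp: swap_mat_def matrix_entry_carrier transpose_less\<close>)

lemma mult_swap_mat_entry:
  assumes "r < n" "s < n" "A \<in> carrier (matrix_ring R n)" "i < n" "j < n"
  shows "(A \<otimes>\<^bsub>matrix_ring R n\<^esub> swap_mat R n r s) (i, j) = A (i, transpose r s j)"
  unfolding matrix_mult_entry[OF assms(4,5)]
  by (rule finsum_delta[where g = "\<lambda>k. A (i, k)"])
    (use assms in \<open>auto simp: swap_mat_def matrix_entry_carrier transpose_less\<close>)

lemma swap_mat_Units:
  assumes "r < n" "s < n"
  shows "swap_mat R n r s \<in> Units (matrix_ring R n)"
proof -
  interpret M: ring "matrix_ring R n" by (rule matrix_ring_is_ring)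
  have "swap_mat R n r s \<otimes>\<^bsub>matrix_ring R n\<^esub> swap_mat R n r s = \<one>\<^bsub>matrix_ring R n\<^esub>"
  proof (rule matrix_eqI[OF M.m_closed[OF swap_mat_carrier swap_mat_carrier] M.one_closed])
    fix i j assume ij: "i < n" "j < n"
    show "(swap_mat R n r s \<otimes>\<^bsub>matrix_ring R n\<^esub> swap_mat R n r s) (i, j) = \<one>\<^bsub>matrix_ring R n\<^esub> (i, j)"
      unfolding swap_mat_mult_entry[OF assms swap_mat_carrier ij] matrix_one_entry[OF ij]
      using assms ij by (simp add: swap_mat_def transpose_less)
  qed
  then show ?thesis using swap_mat_carrier unfolding Units_def by blast
qed

lemma column_mat_carrier:
  "(\<And>i. i < n \<Longrightarrow> x i \<in> carrier R) \<Longrightarrow> column_mat R n k x \<in> carrier (matrix_ring R n)"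
  by (auto simp: column_mat_def intro: mat_carrier)

lemma column_mat_mult_entry:
  assumes k: "k < n" and x: "\<And>i. i < n \<Longrightarrow> x i \<in> carrier R"
    and A: "A \<in> carrier (matrix_ring R n)" and i: "i < n" and j: "j < n"
  shows "(column_mat R n k x \<otimes>\<^bsub>matrix_ring R n\<^esub> A) (i, j)
           = x i \<otimes> A (k, j) \<oplus> (if i = k then \<zero> else A (i, j))"
proof -
  have e: "A (l, j) \<in> carrier R" if "l < n" for l using A that j by (rule matrix_entry_carrier)
  \<comment> \<open>Row i of the column matrix is supported at positions k and i. For i = k these
    coincide, and the second summand is switched off to avoid counting the position twice.\<close>
  have "(column_mat R n k x \<otimes>\<^bsub>matrix_ring R n\<^esub> A) (i, j)
      = (\<Oplus>l\<in>{..<n}. (if k = l then x i \<otimes> A (l, j) else \<zero>)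
                    \<oplus> (if i = l then (if i = k then \<zero> else A (l, j)) else \<zero>))"
    unfolding matrix_mult_entry[OF i j]
    by (rule finsum_cong') (use e x i in \<open>auto simp: column_mat_def\<close>)
  also have "\<dots> = (\<Oplus>l\<in>{..<n}. (if k = l then x i \<otimes> A (l, j) else \<zero>))
      \<oplus> (\<Oplus>l\<in>{..<n}. (if i = l then (if i = k then \<zero> else A (l, j)) else \<zero>))"
    by (rule finsum_addf) (use e x i in auto)
  also have "(\<Oplus>l\<in>{..<n}. (if k = l then x i \<otimes> A (l, j) else \<zero>)) = x i \<otimes> A (k, j)"
    by (rule finsum_delta[where g = "\<lambda>l. x i \<otimes> A (l, j)"]) (use e x i k in auto)
  also have "(\<Oplus>l\<in>{..<n}. (if i = l then (if i = k then \<zero> else A (l, j)) else \<zero>))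
      = (if i = k then \<zero> else A (i, j))"
    by (rule finsum_delta[where g = "\<lambda>l. if i = k then \<zero> else A (l, j)"]) (use e i in auto)
  finally show ?thesis .
qed

lemma column_mat_Units:
  assumes k: "k < n" and x: "\<And>i. i < n \<Longrightarrow> x i \<in> carrier R" and "x k \<in> Units R"
  shows "column_mat R n k x \<in> Units (matrix_ring R n)"
proof -
  let ?v = "inv (x k)"
  \<comment> \<open>The inverse has the same shape: the pivot is inverted, and the other entries are
    determined by cancelling those of \<open>x\<close> in column k.\<close>
  define y where "y i = (if i = k then ?v else \<ominus> (x i \<otimes> ?v))" for i
  have v: "?v \<in> carrier R" using assms(3) by simp
  have y: "y i \<in> carrier R" if "i < n" for i using that x v by (simp add: y_def)
  have cx: "column_mat R n k x \<in> carrier (matrix_ring R n)" by (rule column_mat_carrier) (rule x)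
  have cy: "column_mat R n k y \<in> carrier (matrix_ring R n)" by (rule column_mat_carrier) (rule y)
  interpret M: ring "matrix_ring R n" by (rule matrix_ring_is_ring)
  have 1: "column_mat R n k x \<otimes>\<^bsub>matrix_ring R n\<^esub> column_mat R n k y = \<one>\<^bsub>matrix_ring R n\<^esub>"
  proof (rule matrix_eqI[where R = R])
    fix i j assume ij: "i < n" "j < n"
    show "(column_mat R n k x \<otimes>\<^bsub>matrix_ring R n\<^esub> column_mat R n k y) (i, j) = \<one>\<^bsub>matrix_ring R n\<^esub> (i, j)"
      by (subst column_mat_mult_entry, rule k, rule x, assumption, rule cy, rule ij, rule ij)
        (use ij k x v assms(3) in \<open>auto simp: column_mat_def y_def r_neg matrix_one_entry\<close>)
  qed (simp_all add: cx cy)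
  have 2: "column_mat R n k y \<otimes>\<^bsub>matrix_ring R n\<^esub> column_mat R n k x = \<one>\<^bsub>matrix_ring R n\<^esub>"
  proof (rule matrix_eqI[where R = R])
    fix i j assume ij: "i < n" "j < n"
    show "(column_mat R n k y \<otimes>\<^bsub>matrix_ring R n\<^esub> column_mat R n k x) (i, j) = \<one>\<^bsub>matrix_ring R n\<^esub> (i, j)"
      by (subst column_mat_mult_entry, rule k, rule y, assumption, rule cx, rule ij, rule ij)
        (use ij k x v assms(3) in \<open>auto simp: column_mat_def y_def l_minus m_assoc l_neg matrix_one_entry\<close>)
  qed (simp_all add: cx cy)
  show ?thesis using 1 2 cx cy unfolding Units_def by blast
qed

text \<open>The prefix \<open>w\<close> replaces an explicit expansion of the power into words. Each
  factor split off from the left of the power moves one entry of A into \<open>w\<close>; when the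
  power is exhausted, \<open>w\<close> has length k and vanishes.\<close>

lemma list_product_mult_matrix_pow_zero:
  assumes A: "A \<in> carrier (matrix_ring R n)"
    and words: "\<And>w. set w \<subseteq> A ` ({..<n} \<times> {..<n}) \<Longrightarrow> length w = k \<Longrightarrow> list_product R w = \<zero>"
    and "set w \<subseteq> A ` ({..<n} \<times> {..<n})" "length w + m = k" "i < n" "j < n"
  shows "list_product R w \<otimes> (A [^]\<^bsub>matrix_ring R n\<^esub> m) (i, j) = \<zero>"
proof -
  interpret M: ring "matrix_ring R n" by (rule matrix_ring_is_ring)
  show ?thesis
    using assms(3-)
  proof (induction m arbitrary: w i)
    case 0
    then have "list_product R w = \<zero>" by (intro words) simp_all
    moreover have "(A [^]\<^bsub>matrix_ring R n\<^esub> (0::nat)) (i, j) \<in> carrier R"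
      by (rule matrix_entry_carrier[OF M.nat_pow_closed[OF A]]) (use 0 in simp_all)
    ultimately show ?case by simp
  next
    case (Suc m)
    let ?P = "A [^]\<^bsub>matrix_ring R n\<^esub> m"
    have F: "A ` ({..<n} \<times> {..<n}) \<subseteq> carrier R" using A by (rule matrix_entries_subset)
    have w: "set w \<subseteq> carrier R" using Suc.prems(1) F by (rule subset_trans)
    have P: "?P (l, j) \<in> carrier R" if "l < n" for l
      by (rule matrix_entry_carrier[OF M.nat_pow_closed[OF A] that Suc.prems(4)])
    have a: "A (i, l) \<in> carrier R" if "l < n" for l using A Suc.prems(3) that by (rule matrix_entry_carrier)
    have "A [^]\<^bsub>matrix_ring R n\<^esub> Suc m = A \<otimes>\<^bsub>matrix_ring R n\<^esub> ?P" using A by (rule M.nat_pow_Suc2)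
    then have "list_product R w \<otimes> (A [^]\<^bsub>matrix_ring R n\<^esub> Suc m) (i, j)
        = list_product R w \<otimes> (\<Oplus>l\<in>{..<n}. A (i, l) \<otimes> ?P (l, j))"
      using Suc.prems by (simp only: matrix_mult_entry)
    also have "\<dots> = (\<Oplus>l\<in>{..<n}. list_product R w \<otimes> (A (i, l) \<otimes> ?P (l, j)))"
      using list_product_closed[OF w] a P by (intro finsum_rdistr) auto
    also have "\<dots> = (\<Oplus>l\<in>{..<n}. \<zero>)"
    proof (rule finsum_cong')
      fix l assume "l \<in> {..<n}"
      then have l: "l < n" by simp
      have "list_product R w \<otimes> (A (i, l) \<otimes> ?P (l, j)) = list_product R (w @ [A (i, l)]) \<otimes> ?P (l, j)"
        using w a[OF l] P[OF l] list_product_closed[OF w]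
        by (subst list_product_append) (auto simp: m_assoc)
      also have "\<dots> = \<zero>" using Suc.prems l by (intro Suc.IH) auto
      finally show "list_product R w \<otimes> (A (i, l) \<otimes> ?P (l, j)) = \<zero>" .
    qed auto
    finally show ?case by simp
  qed
qed

text \<open>The entries form a finite set, so local nilpotence supplies one exponent that kills all
  words in them. An ideal that is merely nil guarantees no such common exponent.\<close>

lemma matrix_over_locally_nilpotent:
  assumes I: "locally_nilpotent_ideal R I" and A: "A \<in> carrier (matrix_ring R n)"
    and ent: "\<And>i j. i < n \<Longrightarrow> j < n \<Longrightarrow> A (i, j) \<in> I"
  shows "A \<in> nilpotents (matrix_ring R n)"
proof -
  interpret M: ring "matrix_ring R n" by (rule matrix_ring_is_ring)
  let ?F = "A ` ({..<n} \<times> {..<n})"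
  have F: "?F \<subseteq> carrier R" using A by (rule matrix_entries_subset)
  have "finite ?F" "?F \<subseteq> I" using ent by auto
  then have "nilpotent_subrng R (generate_rng R ?F)"
    using I by (simp add: locally_nilpotent_ideal_def)
  then obtain k where k: "\<And>w. set w \<subseteq> ?F \<Longrightarrow> length w = k \<Longrightarrow> list_product R w = \<zero>"
    unfolding nilpotent_generate_rng_iff[OF F] by blast
  have c: "A [^]\<^bsub>matrix_ring R n\<^esub> k \<in> carrier (matrix_ring R n)" using A by (rule M.nat_pow_closed)
  have "A [^]\<^bsub>matrix_ring R n\<^esub> k = \<zero>\<^bsub>matrix_ring R n\<^esub>"
  proof (rule matrix_eqI[OF c M.zero_closed])
    fix i j assume ij: "i < n" "j < n"
    have "list_product R [] \<otimes> (A [^]\<^bsub>matrix_ring R n\<^esub> k) (i, j) = \<zero>"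
      by (rule list_product_mult_matrix_pow_zero[OF A k]) (use ij in auto)
    then show "(A [^]\<^bsub>matrix_ring R n\<^esub> k) (i, j) = \<zero>\<^bsub>matrix_ring R n\<^esub> (i, j)"
      using matrix_entry_carrier[OF c ij] by (simp add: matrix_zero_entry[OF ij])
  qed
  then show ?thesis using A unfolding nilpotents_def by blast
qed

end

section \<open>Entrywise homomorphisms of matrix rings\<close>

context ring_hom_ring
begin

lemma matrix_map_hom:
  "ring_hom_ring (matrix_ring R n) (matrix_ring S n) (\<lambda>A. mat n (\<lambda>i j. h (A (i, j))))"
proof (rule ring_hom_ringI)
  let ?h = "\<lambda>A. mat n (\<lambda>i j. h (A (i, j)))"
  show "ring (matrix_ring R n)" "ring (matrix_ring S n)"
    by (rule R.matrix_ring_is_ring S.matrix_ring_is_ring)+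
  interpret M: ring "matrix_ring R n" by (rule R.matrix_ring_is_ring)
  interpret T: ring "matrix_ring S n" by (rule S.matrix_ring_is_ring)
  have c: "?h A \<in> carrier (matrix_ring S n)" if "A \<in> carrier (matrix_ring R n)" for A
    by (rule mat_carrier) (rule hom_closed[OF matrix_entry_carrier[OF that]])
  then show "A \<in> carrier (matrix_ring R n) \<Longrightarrow> ?h A \<in> carrier (matrix_ring S n)" for A .
  show "?h \<one>\<^bsub>matrix_ring R n\<^esub> = \<one>\<^bsub>matrix_ring S n\<^esub>"
    by (rule matrix_eqI[OF c[OF M.one_closed] T.one_closed]) (simp add: matrix_one_entry)
  fix A B assume A: "A \<in> carrier (matrix_ring R n)" and B: "B \<in> carrier (matrix_ring R n)"
  show "?h (A \<otimes>\<^bsub>matrix_ring R n\<^esub> B) = ?h A \<otimes>\<^bsub>matrix_ring S n\<^esub> ?h B"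
  proof (rule matrix_eqI[OF c[OF M.m_closed[OF A B]] T.m_closed[OF c[OF A] c[OF B]]])
    fix i j assume ij: "i < n" "j < n"
    have e: "A (i, k) \<in> carrier R" "B (k, j) \<in> carrier R" if "k < n" for k
      using that ij A B by (simp_all add: matrix_entry_carrier)
    have "?h (A \<otimes>\<^bsub>matrix_ring R n\<^esub> B) (i, j) = (\<Oplus>\<^bsub>S\<^esub>k\<in>{..<n}. h (A (i, k) \<otimes> B (k, j)))"
      using ij e by (simp add: matrix_mult_entry hom_finsum comp_def Pi_def del: hom_mult)
    also have "\<dots> = (\<Oplus>\<^bsub>S\<^esub>k\<in>{..<n}. ?h A (i, k) \<otimes>\<^bsub>S\<^esub> ?h B (k, j))"
      by (rule S.finsum_cong') (use ij e in auto)
    finally show "?h (A \<otimes>\<^bsub>matrix_ring R n\<^esub> B) (i, j) = (?h A \<otimes>\<^bsub>matrix_ring S n\<^esub> ?h B) (i, j)"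
      using ij by (simp only: matrix_mult_entry)
  qed
  show "?h (A \<oplus>\<^bsub>matrix_ring R n\<^esub> B) = ?h A \<oplus>\<^bsub>matrix_ring S n\<^esub> ?h B"
    by (rule matrix_eqI[OF c[OF M.a_closed[OF A B]] T.a_closed[OF c[OF A] c[OF B]]])
      (use A B in \<open>simp add: matrix_add_entry matrix_entry_carrier\<close>)
qed

lemma matrix_map_surj:
  assumes surj: "h ` carrier R = carrier S"
  shows "(\<lambda>A. mat n (\<lambda>i j. h (A (i, j)))) ` carrier (matrix_ring R n) = carrier (matrix_ring S n)"
proof (intro equalityI subsetI)
  interpret H: ring_hom_ring "matrix_ring R n" "matrix_ring S n" "\<lambda>A. mat n (\<lambda>i j. h (A (i, j)))"
    by (rule matrix_map_hom)
  show "B \<in> carrier (matrix_ring S n)"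
    if "B \<in> (\<lambda>A. mat n (\<lambda>i j. h (A (i, j)))) ` carrier (matrix_ring R n)" for B
    using that by auto
  fix B assume B: "B \<in> carrier (matrix_ring S n)"
  have "\<exists>x. x \<in> carrier R \<and> h x = B (i, j)" if "i < n" "j < n" for i j
  proof -
    have "B (i, j) \<in> h ` carrier R" unfolding surj by (rule matrix_entry_carrier[OF B that])
    then show ?thesis by auto
  qed
  then obtain a where a: "\<And>i j. i < n \<Longrightarrow> j < n \<Longrightarrow> a i j \<in> carrier R \<and> h (a i j) = B (i, j)"
    by metis
  have c: "mat n a \<in> carrier (matrix_ring R n)" using a by (intro mat_carrier) auto
  have "mat n (\<lambda>i j. h (mat n a (i, j))) = B"
    by (rule matrix_eqI[OF H.hom_closed[OF c] B]) (use a in auto)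
  then show "B \<in> (\<lambda>A. mat n (\<lambda>i j. h (A (i, j)))) ` carrier (matrix_ring R n)"
    using c by (rule image_eqI[OF sym])
qed

end

section \<open>Elimination over a reduced ring\<close>

text \<open>The central idempotent \<open>f\<close> plays the role of \<open>1\<close>: all entries lie in the ideal it generates, and
  the first \<open>k\<close> columns are \<open>f\<close> times those of the identity matrix.\<close>

definition pivoted :: "('a, 'b) ring_scheme \<Rightarrow> nat \<Rightarrow> 'a \<Rightarrow> nat \<Rightarrow> (nat \<times> nat \<Rightarrow> 'a) \<Rightarrow> bool" where
  "pivoted R n f k B \<longleftrightarrow>
     idempotent_elem R f \<and> B \<in> carrier (matrix_ring R n) \<and> k \<le> n \<and>
     (\<forall>i<n. \<forall>j<n. f \<otimes>\<^bsub>R\<^esub> B (i, j) = B (i, j)) \<and>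
     (\<forall>i<k. B (i, i) = f) \<and> (\<forall>i<k. \<forall>j<n. j \<noteq> i \<longrightarrow> B (j, i) = \<zero>\<^bsub>R\<^esub>)"

context ring
begin

text \<open>With pivot rows and columns first, the matrix has the block form ((f I, X), (0, 0)),
  where f X = X. Its square is ((f I, f X), (0, 0)), the same matrix.\<close>

lemma pivoted_idempotent:
  assumes piv: "pivoted R n f k B"
    and z: "\<And>r c. \<lbrakk>k \<le> r; r < n; k \<le> c; c < n\<rbrakk> \<Longrightarrow> B (r, c) = \<zero>"
  shows "B \<otimes>\<^bsub>matrix_ring R n\<^esub> B = B"
proof -
  interpret M: ring "matrix_ring R n" by (rule matrix_ring_is_ring)
  have B: "B \<in> carrier (matrix_ring R n)" using piv by (simp add: pivoted_def)
  have e: "B (i, j) \<in> carrier R" if "i < n" "j < n" for i j by (rule matrix_entry_carrier[OF B that])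
  have low: "B (i, j) = \<zero>" if "k \<le> i" "i < n" "j < n" for i j
    using that z piv by (cases "j < k") (auto simp: pivoted_def)
  show ?thesis
  proof (rule matrix_eqI[OF M.m_closed[OF B B] B])
    fix i j assume ij: "i < n" "j < n"
    show "(B \<otimes>\<^bsub>matrix_ring R n\<^esub> B) (i, j) = B (i, j)"
      unfolding matrix_mult_entry[OF ij]
    proof (rule finsum_delta[where g = "\<lambda>l. B (l, j)" and i = i])
      fix l assume "l \<in> {..<n}"
      then have l: "l < n" by simp
      show "B (l, j) \<in> carrier R" using l ij by (intro e)
      show "B (i, l) \<otimes> B (l, j) = (if i = l then B (l, j) else \<zero>)"
      proof (cases "i < k")
        case True
        show ?thesis
        proof (cases "l < k")
          case True
          then show ?thesis using \<open>i < k\<close> piv ij l e[OF l ij(2)] by (auto simp: pivoted_def)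
        next
          case False
          then show ?thesis using True low[of l j] l ij e[OF ij(1) l] by auto
        qed
      next
        case False
        then show ?thesis using low[of i l] low[of i j] ij l e[OF l ij(2)] by auto
      qed
    qed (use ij in auto)
  qed
qed

end

context reduced_ring
begin

lemma idempotent_left_comm:
  assumes "idempotent_elem R e" "x \<in> carrier R" "y \<in> carrier R"
  shows "x \<otimes> (e \<otimes> y) = e \<otimes> (x \<otimes> y)"
proof -
  have e: "e \<in> carrier R" "e \<otimes> e = e" using assms(1) by (auto simp: idempotent_elem_def)
  have "x \<otimes> (e \<otimes> y) = (x \<otimes> e) \<otimes> y" using e assms by (simp add: m_assoc)
  also have "\<dots> = e \<otimes> (x \<otimes> y)" unfolding idempotent_central[OF e assms(2)] using e assms by (simp add: m_assoc)
  finally show ?thesis .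
qed

text \<open>Scaling by e passes to the factor eR, where e f takes over the role of the
  identity.\<close>

lemma pivoted_scale:
  assumes e: "idempotent_elem R e" and piv: "pivoted R n f k B"
  shows "pivoted R n (e \<otimes> f) k (scalar_mat R n e \<otimes>\<^bsub>matrix_ring R n\<^esub> B)"
proof -
  interpret M: ring "matrix_ring R n" by (rule matrix_ring_is_ring)
  have B: "B \<in> carrier (matrix_ring R n)" and k: "k \<le> n" and f: "f \<in> carrier R" "f \<otimes> f = f"
    and fB: "\<And>i j. i < n \<Longrightarrow> j < n \<Longrightarrow> f \<otimes> B (i, j) = B (i, j)"
    using piv by (auto simp: pivoted_def idempotent_elem_def)
  have ec: "e \<in> carrier R" "e \<otimes> e = e" using e by (auto simp: idempotent_elem_def)
  have eB: "(scalar_mat R n e \<otimes>\<^bsub>matrix_ring R n\<^esub> B) (i, j) = e \<otimes> B (i, j)" if "i < n" "j < n" for i j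
    by (rule scalar_mat_mult_entry[OF ec(1) B that])
  have b: "B (i, j) \<in> carrier R" if "i < n" "j < n" for i j by (rule matrix_entry_carrier[OF B that])
  have mul: "(e \<otimes> f) \<otimes> (e \<otimes> x) = e \<otimes> (f \<otimes> x)" if "x \<in> carrier R" for x
  proof -
    have "(e \<otimes> f) \<otimes> (e \<otimes> x) = (e \<otimes> e) \<otimes> (f \<otimes> x)"
      by (rule central_mult_mult[OF ec(1) ec(1) f(1) that idempotent_central[OF ec f(1)]])
    then show ?thesis unfolding ec(2) .
  qed
  have "idempotent_elem R (e \<otimes> f)"
    using mul[OF f(1)] f ec by (simp add: idempotent_elem_def)
  moreover have "scalar_mat R n e \<otimes>\<^bsub>matrix_ring R n\<^esub> B \<in> carrier (matrix_ring R n)"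
    by (rule M.m_closed[OF scalar_mat_carrier[OF ec(1)] B])
  moreover have "(e \<otimes> f) \<otimes> (scalar_mat R n e \<otimes>\<^bsub>matrix_ring R n\<^esub> B) (i, j)
      = (scalar_mat R n e \<otimes>\<^bsub>matrix_ring R n\<^esub> B) (i, j)" if "i < n" "j < n" for i j
    unfolding eB[OF that] mul[OF b[OF that]] fB[OF that] ..
  moreover have "(scalar_mat R n e \<otimes>\<^bsub>matrix_ring R n\<^esub> B) (i, i) = e \<otimes> f" if "i < k" for i
    using eB[of i i] that k piv by (simp add: pivoted_def)
  moreover have "(scalar_mat R n e \<otimes>\<^bsub>matrix_ring R n\<^esub> B) (j, i) = \<zero>" if "i < k" "j < n" "j \<noteq> i" for i j
    using eB[of j i] that k piv ec(1) by (simp add: pivoted_def)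
  ultimately show ?thesis using k unfolding pivoted_def by blast
qed

text \<open>Because v B(r,c) = e, the chosen entry is invertible in the factor eR. It is swapped to
  the diagonal position k and used to clear its column. Since r and c are at least k, the swaps do
  not damage the earlier pivot columns.\<close>

lemma pivoted_step:
  assumes piv: "pivoted R n e k B" and rc: "k \<le> r" "r < n" "k \<le> c" "c < n"
    and v: "v \<in> Units R" "v \<otimes> B (r, c) = e"
  shows "\<exists>P\<in>Units (matrix_ring R n). \<exists>Q\<in>Units (matrix_ring R n).
           pivoted R n e (Suc k) (P \<otimes>\<^bsub>matrix_ring R n\<^esub> B \<otimes>\<^bsub>matrix_ring R n\<^esub> Q)"
proof -
  interpret M: ring "matrix_ring R n" by (rule matrix_ring_is_ring)
  have B: "B \<in> carrier (matrix_ring R n)" and idem: "idempotent_elem R e"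
    and e: "e \<in> carrier R" "e \<otimes> e = e"
    and eB: "\<And>i j. i < n \<Longrightarrow> j < n \<Longrightarrow> e \<otimes> B (i, j) = B (i, j)"
    and diag: "\<And>i. i < k \<Longrightarrow> B (i, i) = e"
    and col: "\<And>i j. i < k \<Longrightarrow> j < n \<Longrightarrow> j \<noteq> i \<Longrightarrow> B (j, i) = \<zero>"
    using piv by (auto simp: pivoted_def idempotent_elem_def)
  have k: "k < n" using rc by simp
  have vc: "v \<in> carrier R" using v(1) by (rule Units_closed)
  define T where "T = swap_mat R n r k \<otimes>\<^bsub>matrix_ring R n\<^esub> B"
  define C where "C = T \<otimes>\<^bsub>matrix_ring R n\<^esub> swap_mat R n c k"
  have T: "T \<in> carrier (matrix_ring R n)" unfolding T_def by (rule M.m_closed[OF swap_mat_carrier B])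
  have C: "C \<in> carrier (matrix_ring R n)" unfolding C_def by (rule M.m_closed[OF T swap_mat_carrier])
  have Ce: "C (i, j) = B (transpose r k i, transpose c k j)" if "i < n" "j < n" for i j
    unfolding C_def mult_swap_mat_entry[OF rc(4) k T that]
    unfolding T_def by (rule swap_mat_mult_entry[OF rc(2) k B that(1) transpose_less[OF rc(4) k that(2)]])
  have cc: "C (i, j) \<in> carrier R" if "i < n" "j < n" for i j by (rule matrix_entry_carrier[OF C that])
  have eC: "e \<otimes> C (i, j) = C (i, j)" if "i < n" "j < n" for i j
    unfolding Ce[OF that] by (rule eB[OF transpose_less[OF rc(2) k that(1)] transpose_less[OF rc(4) k that(2)]])
  have Ckk: "v \<otimes> C (k, k) = e" using v(2) Ce[OF k k] by simp
  \<comment> \<open>Row k is multiplied by \<open>v\<close>, which turns the pivot into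
    \<open>e\<close>; subtracting C(i,k) times that new row from row i then clears column k, because
    e fixes every entry of C.\<close>
  define x where "x i = (if i = k then v else \<ominus> (C (i, k) \<otimes> v))" for i
  have x: "x i \<in> carrier R" if "i < n" for i using vc cc[OF that k] by (simp add: x_def)
  define D where "D = column_mat R n k x \<otimes>\<^bsub>matrix_ring R n\<^esub> C"
  have L: "column_mat R n k x \<in> Units (matrix_ring R n)"
    by (rule column_mat_Units[OF k]) (use x v(1) in \<open>auto simp: x_def\<close>)
  have D: "D \<in> carrier (matrix_ring R n)" unfolding D_def by (rule M.m_closed[OF M.Units_closed[OF L] C])
  have De: "D (i, j) = x i \<otimes> C (k, j) \<oplus> (if i = k then \<zero> else C (i, j))" if "i < n" "j < n" for i j
    unfolding D_def by (rule column_mat_mult_entry[OF k _ C that]) (rule x)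
  have "e \<otimes> D (i, j) = D (i, j)" if ij: "i < n" "j < n" for i j
  proof -
    have "e \<otimes> D (i, j) = e \<otimes> (x i \<otimes> C (k, j)) \<oplus> e \<otimes> (if i = k then \<zero> else C (i, j))"
      unfolding De[OF ij] using e x[OF ij(1)] cc[OF ij] cc[OF k ij(2)] by (intro r_distr) auto
    also have "e \<otimes> (x i \<otimes> C (k, j)) = x i \<otimes> C (k, j)"
      using idempotent_left_comm[OF idem x[OF ij(1)] cc[OF k ij(2)]] eC[OF k ij(2)] by simp
    also have "e \<otimes> (if i = k then \<zero> else C (i, j)) = (if i = k then \<zero> else C (i, j))"
      using eC[OF ij] e by simp
    finally show ?thesis unfolding De[OF ij] .
  qed
  moreover have "D (k, k) = e" using De[OF k k] Ckk e by (simp add: x_def)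
  moreover have "D (j, k) = \<zero>" if j: "j < n" "j \<noteq> k" for j
  proof -
    have "x j \<otimes> C (k, k) = \<ominus> (C (j, k) \<otimes> (v \<otimes> C (k, k)))"
      using j vc cc[OF j(1) k] cc[OF k k] by (simp add: x_def l_minus m_assoc)
    also have "\<dots> = \<ominus> C (j, k)"
      unfolding Ckk idempotent_central[OF e cc[OF j(1) k]] eC[OF j(1) k] ..
    finally show ?thesis using De[OF j(1) k] j cc[OF j(1) k] by (simp add: l_neg)
  qed
  \<comment> \<open>An earlier pivot column of C has a zero in row k, so the row operation adds
    nothing to that column.\<close>
  moreover have Di: "D (j, i) = B (j, i)" if ij: "i < k" "j < n" and "j = i \<or> B (j, i) = \<zero>" for i j
  proof -
    have i: "i < n" "transpose c k i = i" "transpose r k i = i" using ij k rc by (auto simp: transpose_def)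
    have 1: "C (l, i) = (if l = i then e else \<zero>)" if l: "l < n" for l
    proof (cases "l = i")
      case True
      then show ?thesis using Ce[OF l i(1)] i diag[OF ij(1)] by simp
    next
      case False
      then have "transpose r k l \<noteq> i" using i(3) by (metis transpose_involutory)
      then show ?thesis using False Ce[OF l i(1)] i(2) col[OF ij(1) transpose_less[OF rc(2) k l]] by simp
    qed
    have "D (j, i) = (if j = i then e else \<zero>)"
      using De[OF ij(2) i(1)] 1[OF k] 1[OF ij(2)] ij x[OF ij(2)] e by auto
    then show ?thesis using diag[OF ij(1)] col[OF ij] by auto
  qed
  ultimately have "pivoted R n e (Suc k) D"
    using idem D k diag col unfolding pivoted_def by (auto simp: less_Suc_eq)
  moreover have "D = (column_mat R n k x \<otimes>\<^bsub>matrix_ring R n\<^esub> swap_mat R n r k)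
      \<otimes>\<^bsub>matrix_ring R n\<^esub> B \<otimes>\<^bsub>matrix_ring R n\<^esub> swap_mat R n c k"
    using M.Units_closed[OF L] B swap_mat_carrier unfolding D_def C_def T_def by (simp add: M.m_assoc)
  ultimately show ?thesis
    using M.Units_m_closed[OF L swap_mat_Units[OF rc(2) k]] swap_mat_Units[OF rc(4) k] by metis
qed

text \<open>Idempotents of a reduced ring are central, so e I and (1-e) I are complementary central
  idempotents of the matrix ring and \<open>unit_regular_elem_patch\<close> applies.\<close>

lemma unit_regular_matrix_split:
  assumes e: "idempotent_elem R e" and B: "B \<in> carrier (matrix_ring R n)"
    and "unit_regular_elem (matrix_ring R n) (scalar_mat R n e \<otimes>\<^bsub>matrix_ring R n\<^esub> B)"
    and "unit_regular_elem (matrix_ring R n) (scalar_mat R n (\<one> \<ominus> e) \<otimes>\<^bsub>matrix_ring R n\<^esub> B)"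
  shows "unit_regular_elem (matrix_ring R n) B"
proof -
  interpret M: ring "matrix_ring R n" by (rule matrix_ring_is_ring)
  have ec: "e \<in> carrier R" "e \<otimes> e = e" using e by (auto simp: idempotent_elem_def)
  have hc: "\<one> \<ominus> e \<in> carrier R" using ec by simp
  have eh: "e \<otimes> (\<one> \<ominus> e) = \<zero>" using ec by (simp add: minus_eq r_distr r_minus r_neg)
  have hh: "(\<one> \<ominus> e) \<otimes> (\<one> \<ominus> e) = \<one> \<ominus> e"
    using ec by (simp add: minus_eq l_distr l_minus r_distr r_minus r_neg)
  have sq: "scalar_mat R n g \<otimes>\<^bsub>matrix_ring R n\<^esub> scalar_mat R n g = scalar_mat R n g"
    if g: "g \<in> carrier R" "g \<otimes> g = g" for g
  proof (rule matrix_eqI[OF M.m_closed[OF scalar_mat_carrier[OF g(1)] scalar_mat_carrier[OF g(1)]] scalar_mat_carrier[OF g(1)]])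
    fix i j assume ij: "i < n" "j < n"
    show "(scalar_mat R n g \<otimes>\<^bsub>matrix_ring R n\<^esub> scalar_mat R n g) (i, j) = scalar_mat R n g (i, j)"
      unfolding scalar_mat_mult_entry[OF g(1) scalar_mat_carrier[OF g(1)] ij]
      using g ij by (simp add: scalar_mat_def)
  qed
  have comm: "Y \<otimes>\<^bsub>matrix_ring R n\<^esub> scalar_mat R n g = scalar_mat R n g \<otimes>\<^bsub>matrix_ring R n\<^esub> Y"
    if g: "g \<in> carrier R" "g \<otimes> g = g" and Y: "Y \<in> carrier (matrix_ring R n)" for g Y
  proof (rule matrix_eqI[OF M.m_closed[OF Y scalar_mat_carrier[OF g(1)]] M.m_closed[OF scalar_mat_carrier[OF g(1)] Y]])
    fix i j assume ij: "i < n" "j < n"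
    show "(Y \<otimes>\<^bsub>matrix_ring R n\<^esub> scalar_mat R n g) (i, j) = (scalar_mat R n g \<otimes>\<^bsub>matrix_ring R n\<^esub> Y) (i, j)"
      unfolding scalar_mat_mult_entry[OF g(1) Y ij] mult_scalar_mat_entry[OF g(1) Y ij]
      by (rule idempotent_central[OF g matrix_entry_carrier[OF Y ij]])
  qed
  have zero: "scalar_mat R n e \<otimes>\<^bsub>matrix_ring R n\<^esub> scalar_mat R n (\<one> \<ominus> e) = \<zero>\<^bsub>matrix_ring R n\<^esub>"
  proof (rule matrix_eqI[OF M.m_closed[OF scalar_mat_carrier[OF ec(1)] scalar_mat_carrier[OF hc]] M.zero_closed])
    fix i j assume ij: "i < n" "j < n"
    show "(scalar_mat R n e \<otimes>\<^bsub>matrix_ring R n\<^esub> scalar_mat R n (\<one> \<ominus> e)) (i, j) = \<zero>\<^bsub>matrix_ring R n\<^esub> (i, j)"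
      unfolding scalar_mat_mult_entry[OF ec(1) scalar_mat_carrier[OF hc] ij]
      using eh ec(1) ij by (simp add: scalar_mat_def matrix_zero_entry)
  qed
  have one: "scalar_mat R n e \<oplus>\<^bsub>matrix_ring R n\<^esub> scalar_mat R n (\<one> \<ominus> e) = \<one>\<^bsub>matrix_ring R n\<^esub>"
  proof (rule matrix_eqI[OF M.a_closed[OF scalar_mat_carrier[OF ec(1)] scalar_mat_carrier[OF hc]] M.one_closed])
    fix i j assume ij: "i < n" "j < n"
    have "e \<oplus> (\<one> \<ominus> e) = \<one>" using ec(1) by algebra
    then show "(scalar_mat R n e \<oplus>\<^bsub>matrix_ring R n\<^esub> scalar_mat R n (\<one> \<ominus> e)) (i, j) = \<one>\<^bsub>matrix_ring R n\<^esub> (i, j)"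
      using ij by (simp add: matrix_add_entry matrix_one_entry scalar_mat_def)
  qed
  show ?thesis
    by (rule M.unit_regular_elem_patch[OF scalar_mat_carrier[OF ec(1)] sq[OF ec] comm[OF ec]
          scalar_mat_carrier[OF hc] sq[OF hc hh] comm[OF hc hh] zero one B assms(3,4)])
qed

text \<open>Two nested inductions. A position of \<open>W\<close> with entry a = B(r,c) is chosen,
  and the matrix is split along the idempotent e = v a. On the e-part the entry becomes a new pivot,
  which lowers n - k; on the (1-e)-part it vanishes, which shrinks \<open>W\<close>. Scaling changes
  both the matrix and its local identity f, so both inductions generalise over them.\<close>

lemma pivoted_unit_regular:
  assumes supp: "\<And>a. a \<in> carrier R \<Longrightarrow> \<exists>u\<in>Units R. idempotent_elem R (u \<otimes> a)"
    and "pivoted R n f k B"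
  shows "unit_regular_elem (matrix_ring R n) B"
  using assms(2)
proof (induction "n - k" arbitrary: f k B rule: less_induct)
  case less
  interpret M: ring "matrix_ring R n" by (rule matrix_ring_is_ring)
  \<comment> \<open>\<open>W\<close> contains the positions outside the pivot rows and columns whose entry may be nonzero.\<close>
  have "unit_regular_elem (matrix_ring R n) B"
    if "finite W" "pivoted R n f k B"
      "\<And>r c. \<lbrakk>k \<le> r; r < n; k \<le> c; c < n; (r, c) \<notin> W\<rbrakk> \<Longrightarrow> B (r, c) = \<zero>" for W f B
    using that
  proof (induction W arbitrary: f B)
    case empty
    have B: "B \<in> carrier (matrix_ring R n)" using empty.prems(1) by (simp add: pivoted_def)
    have "B \<otimes>\<^bsub>matrix_ring R n\<^esub> B = B" by (rule pivoted_idempotent[OF empty.prems(1)]) (use empty.prems(2) in simp)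
    then have "B \<otimes>\<^bsub>matrix_ring R n\<^esub> \<one>\<^bsub>matrix_ring R n\<^esub> \<otimes>\<^bsub>matrix_ring R n\<^esub> B = B" using B by simp
    then show ?case using B M.Units_one_closed unfolding unit_regular_elem_def by blast
  next
    case (insert p W)
    obtain r c where p: "p = (r, c)" by fastforce
    show ?case
    proof (cases "k \<le> r \<and> r < n \<and> k \<le> c \<and> c < n")
      case False
      show ?thesis
        by (rule insert.IH[OF insert.prems(1)], rule insert.prems(2)) (use False p in auto)
    next
      case True
      then have rc: "k \<le> r" "r < n" "k \<le> c" "c < n" by auto
      let ?a = "B (r, c)"
      have B: "B \<in> carrier (matrix_ring R n)" and f: "f \<in> carrier R" "f \<otimes> f = f"
        and fa: "f \<otimes> ?a = ?a"
        using insert.prems(1) rc by (auto simp: pivoted_def idempotent_elem_def)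
      have a: "?a \<in> carrier R" by (rule matrix_entry_carrier[OF B rc(2,4)])
      obtain v where v: "v \<in> Units R" "idempotent_elem R (v \<otimes> ?a)" using supp[OF a] by blast
      define e where "e = v \<otimes> ?a"
      have ie: "idempotent_elem R e" using v(2) by (simp add: e_def)
      then have e: "e \<in> carrier R" "e \<otimes> e = e" by (auto simp: idempotent_elem_def)
      have vc: "v \<in> carrier R" "inv v \<in> carrier R" using v(1) by auto
      have ae: "?a = inv v \<otimes> e" using v(1) a vc by (simp add: e_def m_assoc[symmetric])
      \<comment> \<open>The entry is \<open>inv v\<close> times \<open>e\<close>, so
        \<open>e\<close> fixes it and 1 - e annihilates it.\<close>
      have ea: "e \<otimes> ?a = ?a"
      proof -
        have "e \<otimes> ?a = ?a \<otimes> e" by (rule idempotent_central[OF e a, symmetric])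
        also have "\<dots> = inv v \<otimes> (e \<otimes> e)" unfolding ae using vc e(1) by (simp add: m_assoc)
        finally show ?thesis unfolding e(2) ae[symmetric] .
      qed
      \<comment> \<open>The entry lies in the factor of \<open>f\<close>, hence so does
        \<open>e\<close>; thus the local identity of the scaled matrix is \<open>e\<close> itself,
        as \<open>pivoted_step\<close> requires.\<close>
      have ef: "e \<otimes> f = e"
      proof -
        have "e \<otimes> f = v \<otimes> (?a \<otimes> f)" unfolding e_def using vc a f(1) by (simp add: m_assoc)
        then show ?thesis unfolding idempotent_central[OF f a] fa e_def[symmetric] .
      qed
      let ?E = "scalar_mat R n e \<otimes>\<^bsub>matrix_ring R n\<^esub> B"
      let ?H = "scalar_mat R n (\<one> \<ominus> e) \<otimes>\<^bsub>matrix_ring R n\<^esub> B"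
      have Ec: "?E \<in> carrier (matrix_ring R n)" by (rule M.m_closed[OF scalar_mat_carrier[OF e(1)] B])
      have pE: "pivoted R n e k ?E" using pivoted_scale[OF ie insert.prems(1)] unfolding ef .
      have "v \<otimes> ?E (r, c) = e"
        unfolding scalar_mat_mult_entry[OF e(1) B rc(2,4)] ea by (rule e_def[symmetric])
      from pivoted_step[OF pE rc v(1) this] obtain P Q
        where PQ: "P \<in> Units (matrix_ring R n)" "Q \<in> Units (matrix_ring R n)"
          "pivoted R n e (Suc k) (P \<otimes>\<^bsub>matrix_ring R n\<^esub> ?E \<otimes>\<^bsub>matrix_ring R n\<^esub> Q)" by blast
      have "unit_regular_elem (matrix_ring R n) (P \<otimes>\<^bsub>matrix_ring R n\<^esub> ?E \<otimes>\<^bsub>matrix_ring R n\<^esub> Q)"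
        by (rule less.hyps[OF _ PQ(3)]) (use rc in simp)
      then have E: "unit_regular_elem (matrix_ring R n) ?E"
        by (rule M.unit_regular_elem_equivalent[OF Ec PQ(1,2)])
      have ih: "idempotent_elem R (\<one> \<ominus> e)"
        using e by (simp add: idempotent_elem_def minus_eq l_distr l_minus r_distr r_minus r_neg)
      have hc: "\<one> \<ominus> e \<in> carrier R" using e by simp
      have "unit_regular_elem (matrix_ring R n) ?H"
      proof (rule insert.IH[OF pivoted_scale[OF ih insert.prems(1)]])
        fix r' c' assume r': "k \<le> r'" "r' < n" "k \<le> c'" "c' < n" "(r', c') \<notin> W"
        have b: "B (r', c') \<in> carrier R" by (rule matrix_entry_carrier[OF B r'(2,4)])
        show "?H (r', c') = \<zero>"
          unfolding scalar_mat_mult_entry[OF hc B r'(2,4)]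
        proof (cases "(r', c') = p")
          case True
          then show "(\<one> \<ominus> e) \<otimes> B (r', c') = \<zero>"
            using ea e(1) a p by (simp add: minus_eq l_distr l_minus r_neg)
        next
          case False
          then have "B (r', c') = \<zero>" using insert.prems(2) r' by simp
          then show "(\<one> \<ominus> e) \<otimes> B (r', c') = \<zero>" using hc by simp
        qed
      qed
      then show ?thesis by (rule unit_regular_matrix_split[OF ie B E])
    qed
  qed
  from this[of "{..<n} \<times> {..<n}" f B] show ?case using less.prems by simp
qed

lemma matrix_ring_unit_regular:
  assumes "\<And>a. a \<in> carrier R \<Longrightarrow> \<exists>u\<in>Units R. idempotent_elem R (u \<otimes> a)"
    and A: "A \<in> carrier (matrix_ring R n)"
  shows "unit_regular_elem (matrix_ring R n) A"
proof (rule pivoted_unit_regular[OF assms(1)])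
  show "pivoted R n \<one> 0 A"
    using A matrix_entry_carrier[OF A] by (simp add: pivoted_def idempotent_elem_def)
qed


section \<open>Cancellation for scalar matrices and regularity\<close>

text \<open>The equation says that \<open>a\<close> annihilates every entry of Z, and
  \<open>mult_zero_insert\<close> lets an entry of V slip in between in each summand. General
  matrices lack this property.\<close>

lemma scalar_mat_mult_zero_insert:
  assumes a: "a \<in> carrier R" and V: "V \<in> carrier (matrix_ring R n)" and Z: "Z \<in> carrier (matrix_ring R n)"
    and z: "scalar_mat R n a \<otimes>\<^bsub>matrix_ring R n\<^esub> Z = \<zero>\<^bsub>matrix_ring R n\<^esub>"
  shows "scalar_mat R n a \<otimes>\<^bsub>matrix_ring R n\<^esub> (V \<otimes>\<^bsub>matrix_ring R n\<^esub> Z) = \<zero>\<^bsub>matrix_ring R n\<^esub>"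
proof -
  interpret M: ring "matrix_ring R n" by (rule matrix_ring_is_ring)
  have VZ: "V \<otimes>\<^bsub>matrix_ring R n\<^esub> Z \<in> carrier (matrix_ring R n)" by (rule M.m_closed[OF V Z])
  have v: "V (i, j) \<in> carrier R" and ze: "Z (i, j) \<in> carrier R" if "i < n" "j < n" for i j
    using matrix_entry_carrier[OF V that] matrix_entry_carrier[OF Z that] by auto
  have az: "a \<otimes> Z (i, j) = \<zero>" if "i < n" "j < n" for i j
    using scalar_mat_mult_entry[OF a Z that] unfolding z matrix_zero_entry[OF that] by (rule sym)
  show ?thesis
  proof (rule matrix_eqI[OF M.m_closed[OF scalar_mat_carrier[OF a] VZ] M.zero_closed])
    fix i j assume ij: "i < n" "j < n"
    have "(scalar_mat R n a \<otimes>\<^bsub>matrix_ring R n\<^esub> (V \<otimes>\<^bsub>matrix_ring R n\<^esub> Z)) (i, j)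
        = a \<otimes> (\<Oplus>k\<in>{..<n}. V (i, k) \<otimes> Z (k, j))"
      unfolding scalar_mat_mult_entry[OF a VZ ij] by (simp only: matrix_mult_entry[OF ij])
    also have "\<dots> = (\<Oplus>k\<in>{..<n}. a \<otimes> (V (i, k) \<otimes> Z (k, j)))"
      using a v ze ij by (intro finsum_rdistr) auto
    also have "\<dots> = (\<Oplus>k\<in>{..<n}. \<zero>)"
    proof (rule finsum_cong')
      fix k assume "k \<in> {..<n}"
      then have k: "k < n" by simp
      show "a \<otimes> (V (i, k) \<otimes> Z (k, j)) = \<zero>"
        by (rule mult_zero_insert[OF a ze[OF k ij(2)] v[OF ij(1) k] az[OF k ij(2)]])
    qed auto
    finally show "(scalar_mat R n a \<otimes>\<^bsub>matrix_ring R n\<^esub> (V \<otimes>\<^bsub>matrix_ring R n\<^esub> Z)) (i, j) = \<zero>\<^bsub>matrix_ring R n\<^esub> (i, j)"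
      by (simp add: matrix_zero_entry[OF ij])
  qed
qed

text \<open>For an entry z, a(a z) = 0 gives (a z) a = 0 by symmetry of zero products, hence (a z)^2
  = 0 and a z = 0.\<close>

lemma scalar_mat_mult_cancel:
  assumes a: "a \<in> carrier R" and Z: "Z \<in> carrier (matrix_ring R n)"
    and z: "scalar_mat R n a \<otimes>\<^bsub>matrix_ring R n\<^esub> (scalar_mat R n a \<otimes>\<^bsub>matrix_ring R n\<^esub> Z) = \<zero>\<^bsub>matrix_ring R n\<^esub>"
  shows "scalar_mat R n a \<otimes>\<^bsub>matrix_ring R n\<^esub> Z = \<zero>\<^bsub>matrix_ring R n\<^esub>"
proof -
  interpret M: ring "matrix_ring R n" by (rule matrix_ring_is_ring)
  have aZ: "scalar_mat R n a \<otimes>\<^bsub>matrix_ring R n\<^esub> Z \<in> carrier (matrix_ring R n)"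
    by (rule M.m_closed[OF scalar_mat_carrier[OF a] Z])
  show ?thesis
  proof (rule matrix_eqI[OF aZ M.zero_closed])
    fix i j assume ij: "i < n" "j < n"
    have x: "Z (i, j) \<in> carrier R" by (rule matrix_entry_carrier[OF Z ij])
    have ax: "a \<otimes> Z (i, j) \<in> carrier R" using a x by simp
    have "a \<otimes> (a \<otimes> Z (i, j)) = \<zero>"
      using arg_cong[OF z, of "\<lambda>Y. Y (i, j)"]
      unfolding scalar_mat_mult_entry[OF a aZ ij] scalar_mat_mult_entry[OF a Z ij] matrix_zero_entry[OF ij] .
    then have 0: "(a \<otimes> Z (i, j)) \<otimes> a = \<zero>" by (rule mult_zero_comm[OF a ax])
    have "(a \<otimes> Z (i, j)) \<otimes> (a \<otimes> Z (i, j)) = ((a \<otimes> Z (i, j)) \<otimes> a) \<otimes> Z (i, j)"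
      using a x by (simp add: m_assoc)
    then have "(a \<otimes> Z (i, j)) \<otimes> (a \<otimes> Z (i, j)) = \<zero>" unfolding 0 using x by simp
    from square_zero[OF ax this]
    show "(scalar_mat R n a \<otimes>\<^bsub>matrix_ring R n\<^esub> Z) (i, j) = \<zero>\<^bsub>matrix_ring R n\<^esub> (i, j)"
      unfolding scalar_mat_mult_entry[OF a Z ij] matrix_zero_entry[OF ij] .
  qed
qed

end

context ring
begin

text \<open>Cancellation applied to z = d^m lowers the exponent from m + 2 to m + 1, so the descent
  ends at d itself.\<close>

lemma nilpotent_zero_of_cancel:
  assumes "d \<in> nilpotents R"
    and cancel: "\<And>z. \<lbrakk>z \<in> carrier R; d \<otimes> (d \<otimes> z) = \<zero>\<rbrakk> \<Longrightarrow> d \<otimes> z = \<zero>"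
  shows "d = \<zero>"
proof -
  obtain m :: nat where d: "d \<in> carrier R" and m: "d [^] m = \<zero>"
    using assms(1) by (auto simp: nilpotents_def)
  have "d [^] Suc m = \<zero>" using d m by simp
  then show ?thesis
  proof (induction m)
    case (Suc m)
    have "d \<otimes> (d \<otimes> d [^] m) = d [^] Suc (Suc m)"
      unfolding nat_pow_Suc2[OF d] ..
    then have "d \<otimes> d [^] m = \<zero>" using Suc.prems d cancel[of "d [^] m"] by simp
    then have "d [^] Suc m = \<zero>" unfolding nat_pow_Suc2[OF d] .
    then show ?case by (rule Suc.IH)
  qed (use d in simp)
qed

text \<open>Stated for a ring that need not be reduced: the cancellation property is demanded only
  of x = u a. It forces the nilpotent component x(1-e) = b(1-e) to vanish, and the remaining
  equation x = (1+b) e can be solved for e.\<close>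

lemma strongly_nil_clean_multiple_regular:
  assumes a: "a \<in> carrier R" and u: "u \<in> Units R" and snc: "strongly_nil_clean_elem R (u \<otimes> a)"
    and cancel: "\<And>z. \<lbrakk>z \<in> carrier R; (u \<otimes> a) \<otimes> ((u \<otimes> a) \<otimes> z) = \<zero>\<rbrakk> \<Longrightarrow> (u \<otimes> a) \<otimes> z = \<zero>"
  shows "\<exists>v\<in>carrier R. a \<otimes> v \<otimes> a = a"
proof -
  define x where "x = u \<otimes> a"
  have uc: "u \<in> carrier R" using u by (rule Units_closed)
  have x: "x \<in> carrier R" using uc a by (simp add: x_def)
  obtain e b where e: "e \<in> carrier R" "e \<otimes> e = e" and b: "b \<in> nilpotents R" "b \<in> carrier R"
    and eb: "e \<otimes> b = b \<otimes> e" and xeb: "x = e \<oplus> b"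
    using snc by (auto simp: strongly_nil_clean_elem_def idempotent_elem_def nilpotents_def x_def)
  define h where "h = \<one> \<ominus> e"
  have h: "h \<in> carrier R" using e by (simp add: h_def)
  have hb: "h \<otimes> b = b \<otimes> h"
    using e(1) b(2) eb by (simp add: h_def minus_eq l_distr r_distr l_minus r_minus)
  have eh: "e \<otimes> h = \<zero>" and he: "h \<otimes> e = \<zero>"
    using e by (simp_all add: h_def minus_eq l_distr r_distr l_minus r_minus r_neg)
  have xh: "x \<otimes> h = b \<otimes> h" unfolding xeb using e(1) b(2) h eh by (simp add: l_distr)
  have hx: "h \<otimes> x = x \<otimes> h" unfolding xh unfolding xeb using e(1) b(2) h he hb by (simp add: r_distr)
  obtain m :: nat where m: "b [^] m = \<zero>" using b(1) by (auto simp: nilpotents_def)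
  have "(b \<otimes> h) [^] m = b [^] m \<otimes> h [^] m" by (rule pow_mult_distrib[OF hb[symmetric] b(2) h])
  then have "x \<otimes> h \<in> nilpotents R" unfolding xh using m b(2) h by (auto simp: nilpotents_def)
  then have xh0: "x \<otimes> h = \<zero>"
  proof (rule nilpotent_zero_of_cancel)
    \<comment> \<open>As h commutes with x and is idempotent, cancellation of x h against z reduces
      to cancellation of x against h z.\<close>
    fix z assume z: "z \<in> carrier R" and 0: "(x \<otimes> h) \<otimes> ((x \<otimes> h) \<otimes> z) = \<zero>"
    have hh: "h \<otimes> h = h"
      using e by (simp add: h_def minus_eq l_distr r_distr l_minus r_minus r_neg)
    have "x \<otimes> (x \<otimes> (h \<otimes> z)) = (x \<otimes> h) \<otimes> ((x \<otimes> h) \<otimes> z)"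
    proof -
      have "(x \<otimes> h) \<otimes> ((x \<otimes> h) \<otimes> z) = x \<otimes> (h \<otimes> x) \<otimes> (h \<otimes> z)" using x h z by (simp add: m_assoc)
      also have "\<dots> = x \<otimes> x \<otimes> ((h \<otimes> h) \<otimes> z)" unfolding hx using x h z by (simp add: m_assoc)
      also have "\<dots> = x \<otimes> (x \<otimes> (h \<otimes> z))" unfolding hh using x h z by (simp add: m_assoc)
      finally show ?thesis by (rule sym)
    qed
    then have "x \<otimes> (x \<otimes> (h \<otimes> z)) = \<zero>" unfolding 0 .
    then have "x \<otimes> (h \<otimes> z) = \<zero>" using cancel[OF m_closed[OF h z]] unfolding x_def by blast
    then show "(x \<otimes> h) \<otimes> z = \<zero>" using x h z by (simp add: m_assoc)
  qed
  have xe: "x \<otimes> e = x"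
  proof -
    have "e \<oplus> h = \<one>" using e(1) unfolding h_def by algebra
    then have "x = x \<otimes> (e \<oplus> h)" using x by simp
    also have "\<dots> = x \<otimes> e" using x e(1) h xh0 by (simp add: r_distr)
    finally show ?thesis by (rule sym)
  qed
  define w where "w = \<one> \<oplus> b"
  have w: "w \<in> Units R"
    using one_minus_nilpotent_Unit[OF uminus_nilpotent[OF b(1)]] b(2) by (simp add: w_def minus_eq)
  have wc: "w \<in> carrier R" "inv w \<in> carrier R" using w by auto
  have "w \<otimes> e = x \<otimes> e"
    unfolding w_def xeb using e b(2) by (simp add: l_distr)
  then have "inv w \<otimes> (w \<otimes> e) = inv w \<otimes> x" unfolding xe by (rule arg_cong)
  then have ewx: "e = inv w \<otimes> x" using w wc e(1) by (simp flip: m_assoc)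
  \<comment> \<open>Cancelling \<open>u\<close> gives a = a e, and substituting e = w^(-1) u a
    exhibits w^(-1) u as the inner inverse of a.\<close>
  have "u \<otimes> (a \<otimes> e) = u \<otimes> a" using xe uc a e(1) by (simp add: x_def m_assoc)
  then have "a \<otimes> e = a" using Units_l_cancel[OF u] a e(1) by simp
  moreover have "a \<otimes> (inv w \<otimes> u) \<otimes> a = a \<otimes> e"
    unfolding ewx x_def using a uc wc by (simp add: m_assoc)
  ultimately have "a \<otimes> (inv w \<otimes> u) \<otimes> a = a" by (rule trans[rotated])
  then show ?thesis using uc wc by blast
qed

end

text \<open>Cancellation for U aI is deduced from that for aI: the outer U cancels, and the inner U,
  trapped between two scalar matrices, is removed by inserting its inverse into a zero
  product.\<close>

lemma (in reduced_ring) matrix_strongly_unit_nil_clean_imp_regular: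
  assumes M: "strongly_unit_nil_clean (matrix_ring R n)" and n: "n \<ge> 1" and a: "a \<in> carrier R"
  shows "\<exists>z\<in>carrier R. a \<otimes> z \<otimes> a = a"
proof -
  interpret M: ring "matrix_ring R n" by (rule matrix_ring_is_ring)
  let ?A = "scalar_mat R n a"
  have A: "?A \<in> carrier (matrix_ring R n)" by (rule scalar_mat_carrier[OF a])
  obtain U where U: "U \<in> Units (matrix_ring R n)"
    and snc: "strongly_nil_clean_elem (matrix_ring R n) (U \<otimes>\<^bsub>matrix_ring R n\<^esub> ?A)"
    using M A by (auto simp: strongly_unit_nil_clean_def)
  have Uc: "U \<in> carrier (matrix_ring R n)" using U by (rule M.Units_closed)
  have iU: "inv\<^bsub>matrix_ring R n\<^esub> U \<in> carrier (matrix_ring R n)" using U by (rule M.Units_inv_closed)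
  have kill: "?A \<otimes>\<^bsub>matrix_ring R n\<^esub> Y = \<zero>\<^bsub>matrix_ring R n\<^esub>"
    if "Y \<in> carrier (matrix_ring R n)" "U \<otimes>\<^bsub>matrix_ring R n\<^esub> ?A \<otimes>\<^bsub>matrix_ring R n\<^esub> Y = \<zero>\<^bsub>matrix_ring R n\<^esub>" for Y
  proof -
    have "U \<otimes>\<^bsub>matrix_ring R n\<^esub> (?A \<otimes>\<^bsub>matrix_ring R n\<^esub> Y) = U \<otimes>\<^bsub>matrix_ring R n\<^esub> \<zero>\<^bsub>matrix_ring R n\<^esub>"
      using that Uc A by (simp add: M.m_assoc)
    then show ?thesis using M.Units_l_cancel[OF U M.m_closed[OF A that(1)] M.zero_closed] by blast
  qed
  have "\<exists>V\<in>carrier (matrix_ring R n). ?A \<otimes>\<^bsub>matrix_ring R n\<^esub> V \<otimes>\<^bsub>matrix_ring R n\<^esub> ?A = ?A"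
  proof (rule M.strongly_nil_clean_multiple_regular[OF A U snc])
    fix Z assume Z: "Z \<in> carrier (matrix_ring R n)"
      and 0: "U \<otimes>\<^bsub>matrix_ring R n\<^esub> ?A \<otimes>\<^bsub>matrix_ring R n\<^esub> (U \<otimes>\<^bsub>matrix_ring R n\<^esub> ?A \<otimes>\<^bsub>matrix_ring R n\<^esub> Z) = \<zero>\<^bsub>matrix_ring R n\<^esub>"
    let ?W = "U \<otimes>\<^bsub>matrix_ring R n\<^esub> ?A \<otimes>\<^bsub>matrix_ring R n\<^esub> Z"
    have W: "?W \<in> carrier (matrix_ring R n)" by (rule M.m_closed[OF M.m_closed[OF Uc A] Z])
    have "?A \<otimes>\<^bsub>matrix_ring R n\<^esub> (inv\<^bsub>matrix_ring R n\<^esub> U \<otimes>\<^bsub>matrix_ring R n\<^esub> ?W) = \<zero>\<^bsub>matrix_ring R n\<^esub>"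
      by (rule scalar_mat_mult_zero_insert[OF a iU W kill[OF W 0]])
    moreover have "inv\<^bsub>matrix_ring R n\<^esub> U \<otimes>\<^bsub>matrix_ring R n\<^esub> ?W = ?A \<otimes>\<^bsub>matrix_ring R n\<^esub> Z"
      using U Uc iU A Z by (simp flip: M.m_assoc)
    ultimately have "?A \<otimes>\<^bsub>matrix_ring R n\<^esub> (?A \<otimes>\<^bsub>matrix_ring R n\<^esub> Z) = \<zero>\<^bsub>matrix_ring R n\<^esub>" by simp
    from scalar_mat_mult_cancel[OF a Z this]
    show "?W = \<zero>\<^bsub>matrix_ring R n\<^esub>" using M.m_assoc[OF Uc A Z] Uc by simp
  qed
  then obtain V where V: "V \<in> carrier (matrix_ring R n)"
    and AVA: "?A \<otimes>\<^bsub>matrix_ring R n\<^esub> V \<otimes>\<^bsub>matrix_ring R n\<^esub> ?A = ?A" by blast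
  have n0: "0 < n" using n by simp
  have "a \<otimes> V (0, 0) \<otimes> a = a"
    using arg_cong[OF AVA, of "\<lambda>Y. Y (0, 0)"]
    unfolding mult_scalar_mat_entry[OF a M.m_closed[OF A V] n0 n0] scalar_mat_mult_entry[OF a V n0 n0]
    using n0 by (simp add: scalar_mat_def)
  then show ?thesis using matrix_entry_carrier[OF V n0 n0] by blast
qed

section \<open>Passage between the ring and its matrix ring\<close>

lemma (in ring) matrix_ring_strongly_unit_nil_clean:
  assumes W: "weakly_2_primal R" and snc: "strongly_unit_nil_clean R"
  shows "strongly_unit_nil_clean (matrix_ring R n)"
proof -
  let ?N = "nilpotents R"
  let ?S = "R Quot ?N"
  let ?h = "\<lambda>A. mat n (\<lambda>i j. ?N +> A (i, j))"
  have LN: "locally_nilpotent_ideal R ?N"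
    using levitzki_radical_greatest(1) W unfolding weakly_2_primal_def by simp
  then have N: "ideal ?N R" by (simp add: locally_nilpotent_ideal_def)
  interpret S: reduced_ring ?S by (rule quotient_nilpotents_reduced[OF N])
  interpret Q: nil_extension R ?S "(+>) ?N" by (rule quotient_nilpotents_nil_extension[OF N])
  have "strongly_unit_nil_clean ?S" by (rule Q.hom_strongly_unit_nil_clean[OF snc Q.surj])
  \<comment> \<open>Over the reduced quotient a strongly nil-clean element is idempotent, so strong
    unit nil-cleanness supplies exactly the idempotents needed for elimination.\<close>
  then have supp: "\<exists>u\<in>Units ?S. idempotent_elem ?S (u \<otimes>\<^bsub>?S\<^esub> s)" if "s \<in> carrier ?S" for s
    using that S.strongly_nil_clean_idempotent unfolding strongly_unit_nil_clean_def by blast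
  interpret MS: ring "matrix_ring ?S n" by (rule S.matrix_ring_is_ring)
  interpret M: nil_extension "matrix_ring R n" "matrix_ring ?S n" ?h
  proof (intro nil_extension.intro nil_extension_axioms.intro)
    show "ring_hom_ring (matrix_ring R n) (matrix_ring ?S n) ?h" by (rule Q.matrix_map_hom)
    show "?h ` carrier (matrix_ring R n) = carrier (matrix_ring ?S n)"
      by (rule Q.matrix_map_surj[OF Q.surj])
    fix A assume A: "A \<in> carrier (matrix_ring R n)" and 0: "?h A = \<zero>\<^bsub>matrix_ring ?S n\<^esub>"
    \<comment> \<open>A kernel matrix has all its entries in the ideal of nilpotents, which weak
      2-primality makes locally nilpotent.\<close>
    show "A \<in> nilpotents (matrix_ring R n)"
    proof (rule matrix_over_locally_nilpotent[OF LN A])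
      fix i j assume ij: "i < n" "j < n"
      have "?N +> A (i, j) = \<zero>\<^bsub>?S\<^esub>"
        using arg_cong[OF 0, of "\<lambda>Y. Y (i, j)"] ij by (simp add: matrix_zero_entry)
      then show "A (i, j) \<in> ?N" using coset_zero_iff[OF N matrix_entry_carrier[OF A ij]] by simp
    qed
  qed
  show ?thesis
    by (rule M.strongly_unit_nil_clean_lift)
      (rule MS.unit_regular_elem_idempotent_mult[OF S.matrix_ring_unit_regular[OF supp]])
qed

lemma (in ring) strongly_unit_nil_clean_of_matrix_ring:
  assumes NI: "NI_ring R" and n: "n \<ge> 1" and snc: "strongly_unit_nil_clean (matrix_ring R n)"
  shows "strongly_unit_nil_clean R"
proof -
  let ?S = "R Quot (nilpotents R)"
  have N: "ideal (nilpotents R) R" using NI by (simp add: NI_ring_def)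
  interpret S: reduced_ring ?S by (rule quotient_nilpotents_reduced[OF N])
  interpret Q: nil_extension R ?S "(+>) (nilpotents R)" by (rule quotient_nilpotents_nil_extension[OF N])
  have MS: "strongly_unit_nil_clean (matrix_ring ?S n)"
    by (rule ring_hom_ring.hom_strongly_unit_nil_clean[OF Q.matrix_map_hom snc Q.matrix_map_surj[OF Q.surj]])
  show ?thesis
  proof (rule Q.strongly_unit_nil_clean_lift)
    fix s assume s: "s \<in> carrier ?S"
    obtain z where "z \<in> carrier ?S" "s \<otimes>\<^bsub>?S\<^esub> z \<otimes>\<^bsub>?S\<^esub> s = s"
      using S.matrix_strongly_unit_nil_clean_imp_regular[OF MS n s] by blast
    then show "\<exists>u\<in>Units ?S. idempotent_elem ?S (u \<otimes>\<^bsub>?S\<^esub> s)"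
      by (rule S.regular_imp_idempotent_multiple[OF s])
  qed
qed

theorem theorem3p4:
  fixes R :: "('a, 'b) ring_scheme" and n :: nat
  assumes "ring R" and "n \<ge> 1"
  shows "(weakly_2_primal R \<and> strongly_unit_nil_clean R
            \<longrightarrow> strongly_unit_nil_clean (matrix_ring R n)) \<and>
         (NI_ring R \<and> strongly_unit_nil_clean (matrix_ring R n)
            \<longrightarrow> strongly_unit_nil_clean R)"
  using ring.matrix_ring_strongly_unit_nil_clean[OF assms(1)]
    ring.strongly_unit_nil_clean_of_matrix_ring[OF assms(1) _ assms(2)] by blast

end
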